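(* (Infinite comb.) Let $\alpha_{1,n},\alpha_{2,n}\in(0,1)$ for $n\in\overline{\mathbb{N}}^*=\mathbb{N}^*\cup\{\infty\}$, and let $\Theta_1=\sum_{n\ge1}\prod_{k=1}^{n-1}(1-\alpha_{1,k})$. (i) Let $(X_n,M_n)_{n\in\mathbb{Z}}$ be a stationary Markov chain with values in $\{0,1\}\times\overline{\mathbb{N}}^*$ and the transition probabilities given in the context. Suppose that $\Theta_1<\infty$ and that $\alpha_{2,n}=\alpha_2$ for all $n\in\overline{\mathbb{N}}^*$. For $n\in\mathbb{N}$ define the left-infinite word $U_n=\ldots X_{n-2}X_{n-1}X_n$. Then $(U_n)_{n\ge0}$ is a stationary variable length Markov chain associated with the infinite comb with $$q_1(0)=\alpha_2,\qquad q_{0^n1}(1)=\alpha_{1,n}\ (n\ge 1),\qquad q_{0^\infty}(1)=\alpha_{1,\infty}, \qquad (\ast)$$ and its initial distribution is given by $U_0\overset{(d)}{=}\ldots X_{-2}X_{-1}X_0$. (ii) Conversely, let $(U_n)_{n\ge0}$ be a stationary variable length Markov chain associated with the infinite comb satisfying $(\ast)$. For $n\ge0$, let $X_n$ be the last letter of $U_n$ and define $$M_n=1+\sup\{0\le i\le n:\ X_{n-j}=X_n\ \text{ for all } j\in\{0,\ldots,i\}\}.$$ Then $\Theta_1<\infty$ and $(X_n,M_n)_{n\ge0}$ is a stationary Markov chain with the transition probabilities given in the context, where the $\alpha$'s are given by $(\ast)$ and $\alpha_{2,n}=\alpha_2$ for all $n$, and with initial data $(X_0,M_0)$. A stationary Markov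 chain $(X_n,M_n)_{n\in\mathbb{Z}}$ can therefore be defined using the classical procedure of extension from $\mathbb{N}$ to $\mathbb{Z}$.
   Context: Letter/memory chain: with $a_1=0$, $a_2=1$, the transitions on $\{0,1\}\times\overline{\mathbb{N}}^*$ are: from $(a_i,n)$ with $n\in\mathbb{N}^*=\{1,2,\ldots\}$, go to $(a_i,n+1)$ with probability $1-\alpha_{i,n}$ and to $(a_j,1)$, $j\neq i$, with probability $\alpha_{i,n}$; from $(a_i,\infty)$, stay at $(a_i,\infty)$ with probability $1-\alpha_{i,\infty}$ and go to $(a_j,1)$, $j\ne i$, with probability $\alpha_{i,\infty}$. Variable length Markov chain (VLMC): let $\mathcal{L}=\{0,1\}^{-\mathbb{N}}$ be the set of left-infinite words. The infinite comb is the context tree with set of leaves (contexts) $\mathcal{C}=\{0^n1: n\ge0\}\cup\{0^\infty\}$ ($0^01=1$), each context $c$ carrying a probability distribution $q_c$ on $\{0,1\}$. For $U\in\mathcal{L}$, its context $\mathrm{pref}(U)$ is the leaf obtained by reading $U$ from right to left: $\mathrm{pref}(\ldots10^n)=0^n1$ for $n\ge0$, and $\mathrm{pref}(\ldots000)=0^\infty$. The associated VLMC is the $\mathcal{L}$-valued Markov chain with transitions $\mathbb{P}(U_{n+1}=U_n\ell\mid U_n)=q_{\mathrm{pref}(U_n)}(\ell)$, $\ell\in\{0,1\}$.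
   Formalization: In (ii), the supremum defining M_n runs over all i ≥ 0, with letters at negative times read from U_0, instead of 0 ≤ i ≤ n; with the printed truncation M_0 = 1 surely while M_1 = 2 with positive probability, so the chain could not be stationary. *)

theory Defs
  imports "HOL-Probability.Probability" "HOL-Library.Z2" "HOL-Library.Extended_Nat"
begin

text \<open>Processes are indexed by \<^typ>\<open>nat\<close> or \<^typ>\<open>int\<close>.\<close>

definition past ::
  "'a measure \<Rightarrow> 's measure \<Rightarrow> ('i::linordered_semidom \<Rightarrow> 'a \<Rightarrow> 's) \<Rightarrow> 'i \<Rightarrow> 'a measure" where
  "past P S Y n = sigma (space P) {Y k -` A \<inter> space P | k A. k \<le> n \<and> A \<in> sets S}"

definition markov_chain ::
  "'a measure \<Rightarrow> 's measure \<Rightarrow> ('s \<Rightarrow> 's measure) \<Rightarrow> ('i::linordered_semidom \<Rightarrow> 'a \<Rightarrow> 's) \<Rightarrow> bool" where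
  "markov_chain P S Q Y \<longleftrightarrow>
     prob_space P \<and> (\<forall>n. Y n \<in> P \<rightarrow>\<^sub>M S) \<and>
     (\<forall>n. \<forall>A \<in> sets S. AE \<omega> in P.
        real_cond_exp P (past P S Y n) (\<lambda>\<omega>. indicator A (Y (n + 1) \<omega>)) \<omega> = measure (Q (Y n \<omega>)) A)"

definition stationary ::
  "'a measure \<Rightarrow> 's measure \<Rightarrow> ('i::linordered_semidom \<Rightarrow> 'a \<Rightarrow> 's) \<Rightarrow> bool" where
  "stationary P S Y \<longleftrightarrow>
     (\<forall>h. distr P (PiM UNIV (\<lambda>_. S)) (\<lambda>\<omega> n. Y (n + h) \<omega>) =
          distr P (PiM UNIV (\<lambda>_. S)) (\<lambda>\<omega> n. Y n \<omega>))"

definition stationary_markov_chain ::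
  "'a measure \<Rightarrow> 's measure \<Rightarrow> ('s \<Rightarrow> 's measure) \<Rightarrow> ('i::linordered_semidom \<Rightarrow> 'a \<Rightarrow> 's) \<Rightarrow> bool" where
  "stationary_markov_chain P S Q Y \<longleftrightarrow> markov_chain P S Q Y \<and> stationary P S Y"

definition letter_memory_space :: "(bit \<times> enat) measure" where
  "letter_memory_space = count_space (UNIV \<times> {1..})"

text \<open>In the memory component \<^term>\<open>eSuc \<infinity> = \<infinity>\<close>, so the single formula below also covers the
  transitions out of the states with infinite memory. The parameters \<open>\<alpha>1\<close> and \<open>\<alpha>2\<close> belong to
  the letters \<open>0\<close> and \<open>1\<close>, respectively.\<close>

definition letter_memory_kernel ::
  "(enat \<Rightarrow> real) \<Rightarrow> (enat \<Rightarrow> real) \<Rightarrow> bit \<times> enat \<Rightarrow> (bit \<times> enat) measure" where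
  "letter_memory_kernel \<alpha>1 \<alpha>2 = (\<lambda>(a, n).
     distr (measure_pmf (bernoulli_pmf (if a = 0 then \<alpha>1 n else \<alpha>2 n))) letter_memory_space
       (\<lambda>switch. if switch then (1 - a, 1) else (a, eSuc n)))"

text \<open>The \<open>n\<close>-th summand, counted from \<open>0\<close>, is the one usually indexed by \<open>n + 1\<close>.\<close>

definition Theta :: "(enat \<Rightarrow> real) \<Rightarrow> ennreal" where
  "Theta \<alpha> = (\<Sum>n. ennreal (\<Prod>k\<in>{1..<Suc n}. 1 - \<alpha> (enat k)))"

text \<open>A left-infinite word is read from right to left: \<open>w 0\<close> is its last letter.\<close>

type_synonym left_word = "nat \<Rightarrow> bit"

definition left_words :: "left_word measure" where
  "left_words = PiM UNIV (\<lambda>_. count_space UNIV)"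

definition append_letter :: "left_word \<Rightarrow> bit \<Rightarrow> left_word" where
  "append_letter w l = case_nat l w"

text \<open>The leaves of the infinite comb: \<open>Zeros_One n\<close> stands for \<open>0\<^sup>n1\<close> and \<open>Zeros_Inf\<close> for the
  infinite branch of zeros.\<close>

datatype comb_leaf = Zeros_One nat | Zeros_Inf

definition pref :: "left_word \<Rightarrow> comb_leaf" where
  "pref w = (if \<exists>n. w n = 1 then Zeros_One (LEAST n. w n = 1) else Zeros_Inf)"

definition comb_kernel :: "(comb_leaf \<Rightarrow> bit pmf) \<Rightarrow> left_word \<Rightarrow> left_word measure" where
  "comb_kernel q w = distr (measure_pmf (q (pref w))) left_words (append_letter w)"

definition stationary_comb_vlmc ::
  "'a measure \<Rightarrow> (comb_leaf \<Rightarrow> bit pmf) \<Rightarrow> (nat \<Rightarrow> 'a \<Rightarrow> left_word) \<Rightarrow> bool" where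
  "stationary_comb_vlmc P q U \<longleftrightarrow> stationary_markov_chain P left_words (comb_kernel q) U"

definition comb_parameters :: "(enat \<Rightarrow> real) \<Rightarrow> real \<Rightarrow> (comb_leaf \<Rightarrow> bit pmf) \<Rightarrow> bool" where
  "comb_parameters \<alpha>1 a2 q \<longleftrightarrow>
     pmf (q (Zeros_One 0)) 0 = a2 \<and>
     (\<forall>n\<ge>1. pmf (q (Zeros_One n)) 1 = \<alpha>1 (enat n)) \<and>
     pmf (q Zeros_Inf) 1 = \<alpha>1 \<infinity>"

definition word_up_to :: "(int \<Rightarrow> 'a \<Rightarrow> bit) \<Rightarrow> int \<Rightarrow> 'a \<Rightarrow> left_word" where
  "word_up_to X n \<omega> = (\<lambda>k. X (n - int k) \<omega>)"

text \<open>For \<open>n \<ge> 0\<close> the last letter of \<open>U n\<close>; the letters at negative times are those of the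
  initial word \<open>U 0 = \<dots> X\<^sub>-\<^sub>2 X\<^sub>-\<^sub>1 X\<^sub>0\<close>.\<close>

definition letter :: "(nat \<Rightarrow> 'a \<Rightarrow> left_word) \<Rightarrow> int \<Rightarrow> 'a \<Rightarrow> bit" where
  "letter U n \<omega> = (if 0 \<le> n then U (nat n) \<omega> 0 else U 0 \<omega> (nat (- n)))"

text \<open>The length of the final run of equal letters. The supremum ranges over all \<open>i \<ge> 0\<close>, so the run
  may reach into the initial word. Truncating it at \<open>i \<le> n\<close> would force the memory at time \<open>0\<close>
  to be \<open>1\<close>, which is incompatible with stationarity.\<close>

definition memory :: "(int \<Rightarrow> 'a \<Rightarrow> bit) \<Rightarrow> int \<Rightarrow> 'a \<Rightarrow> enat" where
  "memory X n \<omega> = 1 + (SUP i \<in> {i::nat. \<forall>j\<le>i. X (n - int j) \<omega> = X n \<omega>}. enat i)"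

end

theory Submission
  imports Defs
begin

text \<open>The link between the two chains is the map \<open>memory_state\<close>, which sends a left-infinite word to
  its last letter and the length of its final run of equal letters. The context that the comb
  assigns to a word is coarser than this pair: it records the length of a final run of zeros, but
  for a word ending in \<open>1\<close> it only says that the word ends in \<open>1\<close>. Because \<open>\<alpha>2\<close> is constant,
  the letter-memory kernel ignores exactly the information that the context forgets, and the image
  of the comb kernel at \<open>w\<close> under \<open>memory_state\<close> is the letter-memory kernel at \<open>memory_state w\<close>
  (\<open>comb_kernel_memory_state\<close>). Both directions rest on this intertwining.

  From the letter-memory chain to the comb: along a two-sided trajectory, almost surely every step
  either switches the letter and resets the memory, or keeps the letter and increases the memory.
  Following the trajectory backwards, this forces the memory to be the length of the final run of
  the past letters (\<open>final_run_unique\<close>), so the state is almost surely the \<open>memory_state\<close> of the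
  past word. The law of the next letter given the whole past of the chain is then a function
  of the past word, and it is the one that the comb prescribes.

  From the comb to the letter-memory chain: almost surely each word of the chain extends the
  preceding one by one letter. Hence all words are pieces of one two-sided sequence of letters, in
  which the negative times are read off from the initial word. The memory along that sequence
  is a process indexed by \<open>int\<close> on the original probability space, so the two-sided extension
  is simply its law and no projective limit has to be taken. Its Markov property at
  nonnegative times follows from the intertwining, because its past is contained in the past of
  the words; stationarity carries it to negative times (\<open>canonical_stationary_markov_chain\<close>).

  That \<open>Theta \<alpha>1\<close> is finite is a statement about any stationary letter-memory chain with constant
  \<open>\<alpha>2\<close> (\<open>Theta_finite\<close>): by balance, the summands of \<open>Theta \<alpha>1\<close> are proportional to the
  probabilities of the states with letter \<open>0\<close> and finite memory, which sum to at most \<open>1\<close>. The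
  factor of proportionality is the probability of the letter \<open>1\<close> times \<open>a2\<close>, and
  it is positive: without ones the memory would be infinite almost surely, but infinite memory is a
  state that leaks mass at rate \<open>\<alpha>1 \<infinity> > 0\<close> and never regains it.\<close>

section \<open>Conditional laws given the past\<close>

definition stochastic_kernel :: "'s measure \<Rightarrow> ('s \<Rightarrow> 's measure) \<Rightarrow> bool" where
  "stochastic_kernel S Q \<longleftrightarrow>
     (\<forall>s\<in>space S. prob_space (Q s)) \<and> (\<forall>A\<in>sets S. (\<lambda>s. measure (Q s) A) \<in> borel_measurable S)"

text \<open>The integrated form of the statement that \<open>Q (V \<omega>)\<close> is the conditional law of \<open>V'\<close> given \<open>F\<close>. In
  contrast to a statement on versions of conditional expectations, it passes to smaller
  \<open>\<sigma>\<close>-algebras and to image measures by mere substitution.\<close>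

definition has_cond_law ::
  "'a measure \<Rightarrow> 'a measure \<Rightarrow> 's measure \<Rightarrow> ('s \<Rightarrow> 's measure) \<Rightarrow> ('a \<Rightarrow> 's) \<Rightarrow> ('a \<Rightarrow> 's) \<Rightarrow> bool" where
  "has_cond_law P F S Q V V' \<longleftrightarrow>
     (\<forall>A\<in>sets S. \<forall>B\<in>sets F.
        measure P (B \<inter> V' -` A) = (\<integral>\<omega>. indicator B \<omega> * measure (Q (V \<omega>)) A \<partial>P))"

lemma has_cond_lawD:
  assumes "has_cond_law P F S Q V V'" "A \<in> sets S" "B \<in> sets F"
  shows "measure P (B \<inter> V' -` A) = (\<integral>\<omega>. indicator B \<omega> * measure (Q (V \<omega>)) A \<partial>P)"
  using assms unfolding has_cond_law_def by blast

lemma past_generators: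
  "{Y k -` A \<inter> space P | k A. k \<le> n \<and> A \<in> sets S} \<subseteq> Pow (space P)"
  by auto

lemma space_past [simp]: "space (past P S Y n) = space P"
  unfolding past_def using past_generators by (simp add: space_measure_of_conv)

lemma sets_past:
  "sets (past P S Y n) = sigma_sets (space P) {Y k -` A \<inter> space P | k A. k \<le> n \<and> A \<in> sets S}"
  unfolding past_def by (rule sets_measure_of[OF past_generators])

lemma measurable_past:
  assumes "k \<le> n" "Y k \<in> P \<rightarrow>\<^sub>M S"
  shows "Y k \<in> past P S Y n \<rightarrow>\<^sub>M S"
proof (rule measurableI)
  show "Y k \<omega> \<in> space S" if "\<omega> \<in> space (past P S Y n)" for \<omega>
    using that assms(2) by (auto dest: measurable_space)
  show "Y k -` A \<inter> space (past P S Y n) \<in> sets (past P S Y n)" if "A \<in> sets S" for A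
    unfolding sets_past space_past using that assms(1) by (intro sigma_sets.Basic) auto
qed

lemma sets_past_least:
  assumes "space F = space P" "\<And>k. k \<le> n \<Longrightarrow> Y k \<in> F \<rightarrow>\<^sub>M S"
  shows "sets (past P S Y n) \<subseteq> sets F"
proof -
  have "{Y k -` A \<inter> space P | k A. k \<le> n \<and> A \<in> sets S} \<subseteq> sets F"
  proof safe
    fix k A assume "k \<le> n" "A \<in> sets S"
    then show "Y k -` A \<inter> space P \<in> sets F"
      using measurable_sets[OF assms(2)] assms(1) by metis
  qed
  then have "sigma_sets (space F) {Y k -` A \<inter> space P | k A. k \<le> n \<and> A \<in> sets S} \<subseteq> sets F"
    by (rule sets.sigma_sets_subset)
  then show ?thesis
    unfolding sets_past assms(1) .
qed

lemma sets_past_subset: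
  assumes "\<And>k. Y k \<in> P \<rightarrow>\<^sub>M S"
  shows "sets (past P S Y n) \<subseteq> sets P"
  using assms by (intro sets_past_least) auto

lemma subalgebra_past:
  assumes "\<And>k. Y k \<in> P \<rightarrow>\<^sub>M S"
  shows "subalgebra P (past P S Y n)"
  using sets_past_subset[of Y P S n] assms by (simp add: subalgebra_def)

text \<open>Used to transport events of the past of \<open>Z\<close> back along \<open>\<Phi>\<close>, notably when \<open>\<Phi>\<close> maps a sample
  point to its (shifted) trajectory and \<open>Z\<close> is the coordinate process.\<close>

lemma vimage_past:
  assumes "\<Phi> \<in> space P \<rightarrow> space N"
    and "\<And>k. k \<le> n \<Longrightarrow> (\<lambda>\<omega>. Z k (\<Phi> \<omega>)) \<in> F \<rightarrow>\<^sub>M S" "space F = space P"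
    and "B \<in> sets (past N S Z n)"
  shows "\<Phi> -` B \<inter> space P \<in> sets F"
proof -
  let ?G = "vimage_algebra (space P) \<Phi> (past N S Z n)"
  have \<Phi>: "\<Phi> \<in> space P \<rightarrow> space (past N S Z n)"
    using assms(1) by simp
  have "\<Phi> \<in> F \<rightarrow>\<^sub>M past N S Z n"
    unfolding past_def
  proof (rule measurable_measure_of[OF past_generators])
    show "\<Phi> \<in> space F \<rightarrow> space N" using assms by simp
    fix B assume "B \<in> {Z k -` A \<inter> space N | k A. k \<le> n \<and> A \<in> sets S}"
    then obtain k A where B: "B = Z k -` A \<inter> space N" "k \<le> n" "A \<in> sets S" by blast
    have "\<Phi> -` B \<inter> space F = (\<lambda>\<omega>. Z k (\<Phi> \<omega>)) -` A \<inter> space F"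
      using assms(1,3) B by auto
    also have "\<dots> \<in> sets F"
      using B assms(2) by (blast intro: measurable_sets)
    finally show "\<Phi> -` B \<inter> space F \<in> sets F" .
  qed
  from measurable_sets[OF this assms(4)] show ?thesis
    using assms(3) by simp
qed

text \<open>A conditional expectation is characterised by its integrals over the events of the
  \<open>\<sigma>\<close>-algebra. The current state is measurable with respect to its own past, hence so is the
  candidate \<open>measure (Q (Y n \<omega>)) A\<close>, and nothing but these integrals remains of the Markov
  property.\<close>

lemma markov_chain_iff_cond_law:
  fixes Y :: "'i::linordered_semidom \<Rightarrow> 'a \<Rightarrow> 's"
  assumes Q: "stochastic_kernel S Q"
  shows "markov_chain P S Q Y \<longleftrightarrow>
    prob_space P \<and> (\<forall>n. Y n \<in> P \<rightarrow>\<^sub>M S) \<and>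
    (\<forall>n. has_cond_law P (past P S Y n) S Q (Y n) (Y (n + 1)))"
proof (cases "prob_space P \<and> (\<forall>n. Y n \<in> P \<rightarrow>\<^sub>M S)")
  case True
  then interpret prob_space P by simp
  have Y [measurable]: "\<And>n. Y n \<in> P \<rightarrow>\<^sub>M S" using True by simp
  have "(\<forall>A\<in>sets S. AE \<omega> in P. real_cond_exp P (past P S Y n)
            (\<lambda>\<omega>. indicator A (Y (n + 1) \<omega>)) \<omega> = measure (Q (Y n \<omega>)) A)
        \<longleftrightarrow> has_cond_law P (past P S Y n) S Q (Y n) (Y (n + 1))" for n
    unfolding has_cond_law_def
  proof (rule ball_cong[OF refl])
    fix A assume A [measurable]: "A \<in> sets S"
    let ?F = "past P S Y n"
    let ?f = "\<lambda>\<omega>. indicator A (Y (n + 1) \<omega>) :: real"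
    let ?g = "\<lambda>\<omega>. measure (Q (Y n \<omega>)) A"
    have sub: "subalgebra P ?F"
      unfolding subalgebra_def using sets_past_subset[of Y P S n] Y by auto
    interpret F: finite_measure_subalgebra P ?F
      by unfold_locales (rule sub)
    have QA [measurable]: "(\<lambda>s. measure (Q s) A) \<in> borel_measurable S"
      using Q A unfolding stochastic_kernel_def by blast
    have Yn: "Y n \<in> ?F \<rightarrow>\<^sub>M S" by (rule measurable_past) auto
    have gF: "?g \<in> borel_measurable ?F"
      using measurable_compose[OF Yn QA] .
    have g: "integrable P ?g"
    proof (rule integrable_const_bound[where B = 1])
      show "AE \<omega> in P. norm (?g \<omega>) \<le> 1"
      proof (rule AE_I2)
        fix \<omega> assume "\<omega> \<in> space P"
        then have "Y n \<omega> \<in> space S" using measurable_space[OF Y] by blast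
        then have "prob_space (Q (Y n \<omega>))"
          using Q unfolding stochastic_kernel_def by blast
        then show "norm (?g \<omega>) \<le> 1"
          by (simp add: prob_space.prob_le_1)
      qed
    qed measurable
    have f: "integrable P ?f"
      by (rule integrable_const_bound[where B = 1]) auto
    have lhs: "(\<integral>\<omega>\<in>B. ?f \<omega> \<partial>P) = measure P (B \<inter> Y (n + 1) -` A)" if "B \<in> sets ?F" for B
    proof -
      have B: "B \<in> sets P" using that sub unfolding subalgebra_def by blast
      have "B \<inter> Y (n + 1) -` A = B \<inter> (Y (n + 1) -` A \<inter> space P)"
        using sets.sets_into_space[OF B] by auto
      also have "\<dots> \<in> sets P" using B by measurable
      finally have BA: "B \<inter> Y (n + 1) -` A \<in> sets P" .
      have "(\<integral>\<omega>\<in>B. ?f \<omega> \<partial>P) = (\<integral>\<omega>. indicator (B \<inter> Y (n + 1) -` A) \<omega> \<partial>P)"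
        unfolding set_lebesgue_integral_def
        by (rule Bochner_Integration.integral_cong) (auto simp: indicator_def)
      then show ?thesis using BA sets.sets_into_space[OF BA] by (simp add: Int_absorb2)
    qed
    show "(AE \<omega> in P. real_cond_exp P ?F ?f \<omega> = ?g \<omega>) \<longleftrightarrow>
      (\<forall>B\<in>sets ?F. measure P (B \<inter> Y (n + 1) -` A) = (\<integral>\<omega>. indicator B \<omega> * ?g \<omega> \<partial>P))"
    proof
      assume ae: "AE \<omega> in P. real_cond_exp P ?F ?f \<omega> = ?g \<omega>"
      show "\<forall>B\<in>sets ?F. measure P (B \<inter> Y (n + 1) -` A) = (\<integral>\<omega>. indicator B \<omega> * ?g \<omega> \<partial>P)"
      proof
        fix B assume B: "B \<in> sets ?F"
        have [measurable]: "B \<in> sets P" using B sub unfolding subalgebra_def by blast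
        have "measure P (B \<inter> Y (n + 1) -` A) = (\<integral>\<omega>\<in>B. real_cond_exp P ?F ?f \<omega> \<partial>P)"
          using F.real_cond_exp_intA[OF f B] lhs[OF B] by simp
        also have "\<dots> = (\<integral>\<omega>. indicator B \<omega> * ?g \<omega> \<partial>P)"
          unfolding set_lebesgue_integral_def using ae
          by (intro integral_cong_AE) auto
        finally show "measure P (B \<inter> Y (n + 1) -` A) = (\<integral>\<omega>. indicator B \<omega> * ?g \<omega> \<partial>P)" .
      qed
    next
      assume *: "\<forall>B\<in>sets ?F. measure P (B \<inter> Y (n + 1) -` A) = (\<integral>\<omega>. indicator B \<omega> * ?g \<omega> \<partial>P)"
      show "AE \<omega> in P. real_cond_exp P ?F ?f \<omega> = ?g \<omega>"
        by (rule F.real_cond_exp_charact[OF _ f g gF])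
          (use * lhs in \<open>auto simp: set_lebesgue_integral_def\<close>)
    qed
  qed
  then show ?thesis using True unfolding markov_chain_def by blast
qed (auto simp: markov_chain_def)

lemma has_cond_law_mono:
  assumes "has_cond_law P F S Q V V'" "sets G \<subseteq> sets F"
  shows "has_cond_law P G S Q V V'"
  using assms unfolding has_cond_law_def by blast

lemma has_cond_law_cong_AE:
  assumes law: "has_cond_law P F S Q V V'"
    and F: "subalgebra P F" and Q: "stochastic_kernel S Q"
    and meas: "V \<in> P \<rightarrow>\<^sub>M S" "V' \<in> P \<rightarrow>\<^sub>M S" "W \<in> P \<rightarrow>\<^sub>M S" "W' \<in> P \<rightarrow>\<^sub>M S"
    and ae: "AE \<omega> in P. V \<omega> = W \<omega>" "AE \<omega> in P. V' \<omega> = W' \<omega>"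
  shows "has_cond_law P F S Q W W'"
  unfolding has_cond_law_def
proof (intro ballI)
  fix A B assume A [measurable]: "A \<in> sets S" and "B \<in> sets F"
  then have B [measurable]: "B \<in> sets P" using F unfolding subalgebra_def by blast
  note meas [measurable]
  have QA [measurable]: "(\<lambda>s. measure (Q s) A) \<in> borel_measurable S"
    using Q A unfolding stochastic_kernel_def by blast
  have ev: "B \<inter> T -` A \<in> sets P" if "T \<in> P \<rightarrow>\<^sub>M S" for T
  proof -
    have "B \<inter> T -` A = B \<inter> (T -` A \<inter> space P)"
      using sets.sets_into_space[OF B] by auto
    then show ?thesis using that B A by (auto intro!: sets.Int measurable_sets)
  qed
  have "measure P (B \<inter> W' -` A) = measure P (B \<inter> V' -` A)"
    using ae(2) ev meas by (intro measure_eq_AE) auto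
  also have "\<dots> = (\<integral>\<omega>. indicator B \<omega> * measure (Q (V \<omega>)) A \<partial>P)"
    using law A \<open>B \<in> sets F\<close> by (rule has_cond_lawD)
  also have "\<dots> = (\<integral>\<omega>. indicator B \<omega> * measure (Q (W \<omega>)) A \<partial>P)"
    using ae(1) by (intro integral_cong_AE) auto
  finally show "measure P (B \<inter> W' -` A) = (\<integral>\<omega>. indicator B \<omega> * measure (Q (W \<omega>)) A \<partial>P)" .
qed

text \<open>The way to turn the support of a kernel into an almost sure property of trajectories.\<close>

lemma has_cond_law_null:
  assumes law: "has_cond_law P F S Q V V'" and P: "prob_space P"
    and F: "subalgebra P F" and meas: "V' \<in> P \<rightarrow>\<^sub>M S"
    and A: "A \<in> sets S" and B: "B \<in> sets F"
    and null: "\<And>\<omega>. \<omega> \<in> B \<Longrightarrow> measure (Q (V \<omega>)) A = 0"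
  shows "AE \<omega> in P. \<omega> \<in> B \<longrightarrow> V' \<omega> \<notin> A"
proof -
  interpret prob_space P by (rule P)
  have BP: "B \<in> sets P" using B F unfolding subalgebra_def by blast
  have eq: "B \<inter> V' -` A = B \<inter> (V' -` A \<inter> space P)"
    using sets.sets_into_space[OF BP] by auto
  have ev: "B \<inter> V' -` A \<in> sets P"
    unfolding eq using BP A meas by (auto intro!: sets.Int measurable_sets)
  have "measure P (B \<inter> V' -` A) = (\<integral>\<omega>. indicator B \<omega> * measure (Q (V \<omega>)) A \<partial>P)"
    using law A B by (rule has_cond_lawD)
  also have "\<dots> = (\<integral>\<omega>. 0 \<partial>P)"
    using null by (intro Bochner_Integration.integral_cong) (auto simp: indicator_def)
  finally have "measure P (B \<inter> V' -` A) = 0" by simp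
  with ev have "B \<inter> V' -` A \<in> null_sets P"
    by (auto simp: null_sets_def emeasure_eq_measure)
  then have "AE \<omega> in P. \<omega> \<notin> B \<inter> V' -` A" by (rule AE_not_in)
  then show ?thesis by auto
qed

lemma has_cond_law_distr:
  assumes law: "has_cond_law P F S Q (\<lambda>\<omega>. V (\<Phi> \<omega>)) (\<lambda>\<omega>. V' (\<Phi> \<omega>))"
    and \<Phi> [measurable]: "\<Phi> \<in> P \<rightarrow>\<^sub>M N" and Q: "stochastic_kernel S Q"
    and meas [measurable]: "V \<in> N \<rightarrow>\<^sub>M S" "V' \<in> N \<rightarrow>\<^sub>M S"
    and G: "sets G \<subseteq> sets N" "\<And>B. B \<in> sets G \<Longrightarrow> \<Phi> -` B \<inter> space P \<in> sets F"
  shows "has_cond_law (distr P N \<Phi>) G S Q V V'"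
  unfolding has_cond_law_def
proof (intro ballI)
  fix A B assume A [measurable]: "A \<in> sets S" and BG: "B \<in> sets G"
  then have B [measurable]: "B \<in> sets N" using G(1) by blast
  have QA [measurable]: "(\<lambda>s. measure (Q s) A) \<in> borel_measurable S"
    using Q A unfolding stochastic_kernel_def by blast
  have "B \<inter> V' -` A = B \<inter> (V' -` A \<inter> space N)"
    using sets.sets_into_space[OF B] by auto
  also have "\<dots> \<in> sets N" using B by measurable
  finally have BA: "B \<inter> V' -` A \<in> sets N" .
  have "measure (distr P N \<Phi>) (B \<inter> V' -` A) = measure P (\<Phi> -` (B \<inter> V' -` A) \<inter> space P)"
    by (rule measure_distr[OF \<Phi> BA])
  also have "\<Phi> -` (B \<inter> V' -` A) \<inter> space P = (\<Phi> -` B \<inter> space P) \<inter> (\<lambda>\<omega>. V' (\<Phi> \<omega>)) -` A"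
    by auto
  also have "measure P \<dots> =
      (\<integral>\<omega>. indicator (\<Phi> -` B \<inter> space P) \<omega> * measure (Q (V (\<Phi> \<omega>))) A \<partial>P)"
    using law A G(2)[OF BG] by (rule has_cond_lawD)
  also have "\<dots> = (\<integral>\<omega>. indicator B (\<Phi> \<omega>) * measure (Q (V (\<Phi> \<omega>))) A \<partial>P)"
    by (rule Bochner_Integration.integral_cong) (auto simp: indicator_def)
  also have "\<dots> = (\<integral>x. indicator B x * measure (Q (V x)) A \<partial>distr P N \<Phi>)"
    by (rule integral_distr[symmetric, OF \<Phi>]) measurable
  finally show "measure (distr P N \<Phi>) (B \<inter> V' -` A) =
      (\<integral>x. indicator B x * measure (Q (V x)) A \<partial>distr P N \<Phi>)" .
qed


section \<open>Stationary two-sided processes\<close>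

lemma measurable_trajectory:
  assumes "\<And>n. Y n \<in> P \<rightarrow>\<^sub>M S"
  shows "(\<lambda>\<omega> n. Y n \<omega>) \<in> P \<rightarrow>\<^sub>M PiM UNIV (\<lambda>_. S)"
  using assms by (rule measurable_abs_UNIV)

lemma distr_shift_image:
  fixes Y :: "'i::plus \<Rightarrow> 'a \<Rightarrow> 's"
  assumes Y: "\<And>n. Y n \<in> P \<rightarrow>\<^sub>M S" and f: "f \<in> PiM UNIV (\<lambda>_. S) \<rightarrow>\<^sub>M N"
    and shift: "distr P (PiM UNIV (\<lambda>_. S)) (\<lambda>\<omega> n. Y (n + h) \<omega>) =
      distr P (PiM UNIV (\<lambda>_. S)) (\<lambda>\<omega> n. Y n \<omega>)"
  shows "distr P N (\<lambda>\<omega>. f (\<lambda>n. Y (n + h) \<omega>)) = distr P N (\<lambda>\<omega>. f (\<lambda>n. Y n \<omega>))"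
proof -
  have "distr P N (\<lambda>\<omega>. f (\<lambda>n. Y (n + h) \<omega>)) =
      distr (distr P (PiM UNIV (\<lambda>_. S)) (\<lambda>\<omega> n. Y (n + h) \<omega>)) N f"
    using Y f by (subst distr_distr) (auto intro!: measurable_trajectory simp: comp_def)
  also have "\<dots> = distr P N (\<lambda>\<omega>. f (\<lambda>n. Y n \<omega>))"
    unfolding shift using Y f
    by (subst distr_distr) (auto intro!: measurable_trajectory simp: comp_def)
  finally show ?thesis .
qed

text \<open>Shifts by \<open>h\<close> and \<open>-h\<close> are inverse to each other on two-sided trajectories, so a law that is
  invariant under the first is invariant under the second.\<close>

lemma stationary_if_forward_shifts:
  fixes Y :: "int \<Rightarrow> 'a \<Rightarrow> 's"
  assumes Y: "\<And>n. Y n \<in> P \<rightarrow>\<^sub>M S"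
    and shift: "\<And>h::nat. distr P (PiM UNIV (\<lambda>_. S)) (\<lambda>\<omega> n. Y (n + int h) \<omega>) =
      distr P (PiM UNIV (\<lambda>_. S)) (\<lambda>\<omega> n. Y n \<omega>)"
  shows "stationary P S Y"
  unfolding stationary_def
proof
  fix h :: int
  let ?Pi = "PiM UNIV (\<lambda>_. S) :: (int \<Rightarrow> 's) measure"
  show "distr P ?Pi (\<lambda>\<omega> n. Y (n + h) \<omega>) = distr P ?Pi (\<lambda>\<omega> n. Y n \<omega>)"
  proof (cases "h \<ge> 0")
    case True
    then show ?thesis using shift[of "nat h"] by simp
  next
    case False
    then obtain k :: nat where h: "h = - int k"
      by (metis int_cases2 of_nat_0_le_iff)
    have f: "(\<lambda>y n. y (n + h)) \<in> ?Pi \<rightarrow>\<^sub>M ?Pi"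
      by (intro measurable_abs_UNIV) simp
    show ?thesis
      using distr_shift_image[OF Y f shift[of k]] h by simp
  qed
qed

lemma stationary_restrict:
  fixes Y :: "int \<Rightarrow> 'a \<Rightarrow> 's"
  assumes st: "stationary P S Y" and Y: "\<And>n. Y n \<in> P \<rightarrow>\<^sub>M S"
  shows "stationary P S (\<lambda>n::nat. Y (int n))"
  unfolding stationary_def
proof
  fix h :: nat
  have f: "(\<lambda>y n. y (int n)) \<in> PiM UNIV (\<lambda>_. S) \<rightarrow>\<^sub>M (PiM UNIV (\<lambda>_. S) :: (nat \<Rightarrow> 's) measure)"
    by (intro measurable_abs_UNIV) simp
  have "distr P (PiM UNIV (\<lambda>_. S)) (\<lambda>\<omega> n. Y (n + int h) \<omega>) =
      distr P (PiM UNIV (\<lambda>_. S)) (\<lambda>\<omega> n. Y n \<omega>)"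
    using st unfolding stationary_def by blast
  from distr_shift_image[OF Y f this]
  show "distr P (PiM UNIV (\<lambda>_. S)) (\<lambda>\<omega> n. Y (int (n + h)) \<omega>) =
      distr P (PiM UNIV (\<lambda>_. S)) (\<lambda>\<omega> n. Y (int n) \<omega>)"
    by simp
qed

text \<open>The law of \<open>Y\<close> is also the law of \<open>Y\<close> shifted by any \<open>h\<close>. Choosing \<open>h\<close> with \<open>n + h \<ge> 0\<close>, the Markov
  property of the coordinate process at time \<open>n\<close> is inherited from that of \<open>Y\<close> at time
  \<open>n + h\<close>.\<close>

lemma canonical_stationary_markov_chain:
  fixes Y :: "int \<Rightarrow> 'a \<Rightarrow> 's"
  assumes P: "prob_space P" and Q: "stochastic_kernel S Q"
    and Y [measurable]: "\<And>n. Y n \<in> P \<rightarrow>\<^sub>M S" and st: "stationary P S Y"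
    and law: "\<And>n. n \<ge> 0 \<Longrightarrow> has_cond_law P (past P S Y n) S Q (Y n) (Y (n + 1))"
  shows "stationary_markov_chain (distr P (PiM UNIV (\<lambda>_. S)) (\<lambda>\<omega> n. Y n \<omega>)) S Q (\<lambda>n \<omega>. \<omega> n)"
proof -
  let ?Pi = "PiM UNIV (\<lambda>_. S) :: (int \<Rightarrow> 's) measure"
  let ?N = "distr P ?Pi (\<lambda>\<omega> n. Y n \<omega>)"
  have N: "?N = distr P ?Pi (\<lambda>\<omega> n. Y (n + h) \<omega>)" for h
    using st unfolding stationary_def by simp
  have traj: "(\<lambda>\<omega> n. Y (n + h) \<omega>) \<in> P \<rightarrow>\<^sub>M ?Pi" for h
    by (intro measurable_abs_UNIV) simp
  have prob: "prob_space ?N"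
    using prob_space.prob_space_distr[OF P traj[of 0]] by simp
  have coord: "(\<lambda>\<omega>. \<omega> n) \<in> ?N \<rightarrow>\<^sub>M S" for n by simp
  have "has_cond_law ?N (past ?N S (\<lambda>n \<omega>. \<omega> n) n) S Q (\<lambda>\<omega>. \<omega> n) (\<lambda>\<omega>. \<omega> (n + 1))" for n
  proof -
    \<comment> \<open>Any shift that takes \<open>n\<close> to a nonnegative time would do.\<close>
    define h where "h = \<bar>n\<bar>"
    let ?\<Phi> = "\<lambda>\<omega> n. Y (n + h) \<omega>"
    have nh: "n + h \<ge> 0" unfolding h_def by simp
    show ?thesis
      unfolding N[of h]
    proof (rule has_cond_law_distr[where F = "past P S Y (n + h)"])
      show "has_cond_law P (past P S Y (n + h)) S Q (\<lambda>\<omega>. Y (n + h) \<omega>) (\<lambda>\<omega>. Y (n + 1 + h) \<omega>)"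
        using law[OF nh] by (simp add: algebra_simps)
      show "?\<Phi> \<in> P \<rightarrow>\<^sub>M ?Pi" by (rule traj)
      show "stochastic_kernel S Q" by (rule Q)
      show "sets (past (distr P ?Pi ?\<Phi>) S (\<lambda>n \<omega>. \<omega> n) n) \<subseteq> sets ?Pi"
        by (rule sets_past_least) auto
      fix B assume B: "B \<in> sets (past (distr P ?Pi ?\<Phi>) S (\<lambda>n \<omega>. \<omega> n) n)"
      show "?\<Phi> -` B \<inter> space P \<in> sets (past P S Y (n + h))"
      proof (rule vimage_past[OF _ _ _ B])
        show "?\<Phi> \<in> space P \<rightarrow> space (distr P ?Pi ?\<Phi>)"
          using measurable_space[OF traj] by auto
      qed (auto intro!: measurable_past)
    qed simp_all
  qed
  then have "markov_chain ?N S Q (\<lambda>n \<omega>. \<omega> n)"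
    unfolding markov_chain_iff_cond_law[OF Q] using prob coord by blast
  moreover have "stationary ?N S (\<lambda>n \<omega>. \<omega> n)"
    unfolding stationary_def
  proof
    fix h :: int
    have f: "(\<lambda>\<omega> n. \<omega> (n + h)) \<in> ?Pi \<rightarrow>\<^sub>M ?Pi"
      by (intro measurable_abs_UNIV) simp
    have "distr ?N ?Pi (\<lambda>\<omega> n. \<omega> (n + h)) = distr P ?Pi (\<lambda>\<omega> n. Y (n + h) \<omega>)"
      using f traj[of 0] by (subst distr_distr) (auto simp: comp_def)
    also have "\<dots> = distr ?N ?Pi (\<lambda>\<omega> n. \<omega> n)"
      using N[of h] by (simp add: distr_id2)
    finally show "distr ?N ?Pi (\<lambda>\<omega> n. \<omega> (n + h)) = distr ?N ?Pi (\<lambda>\<omega> n. \<omega> n)" .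
  qed
  ultimately show ?thesis
    unfolding stationary_markov_chain_def ..
qed

section \<open>Left-infinite words and their final runs\<close>

lemma bit_UNIV: "(UNIV :: bit set) = {0, 1}"
  by (auto intro: bit.exhaust)

instance bit :: finite
  by standard (simp add: bit_UNIV)

text \<open>The supremum in \<^const>\<open>memory\<close> is replaced by the first position carrying another letter: this
  form makes measurability evident and is directly comparable with \<^const>\<open>pref\<close>.\<close>

definition final_run :: "left_word \<Rightarrow> enat" where
  "final_run w = (if \<exists>j. w j \<noteq> w 0 then enat (LEAST j. w j \<noteq> w 0) else \<infinity>)"

lemma SUP_enat_UNIV: "(SUP i. enat i) = \<infinity>"
proof (rule ccontr)
  assume "(SUP i. enat i) \<noteq> \<infinity>"
  then obtain m where m: "(SUP i. enat i) = enat m" by auto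
  have "enat (Suc m) \<le> (SUP i. enat i)" by (rule SUP_upper) simp
  with m show False by simp
qed

lemma memory_eq_final_run: "memory X n \<omega> = final_run (word_up_to X n \<omega>)"
proof (cases "\<exists>j. word_up_to X n \<omega> j \<noteq> word_up_to X n \<omega> 0")
  case False
  then have "{i::nat. \<forall>j\<le>i. X (n - int j) \<omega> = X n \<omega>} = UNIV"
    by (auto simp: word_up_to_def)
  then show ?thesis
    using False by (simp add: memory_def final_run_def SUP_enat_UNIV)
next
  case True
  let ?w = "word_up_to X n \<omega>"
  define m where "m = (LEAST j. ?w j \<noteq> ?w 0)"
  have m: "?w m \<noteq> ?w 0" unfolding m_def using True by (rule LeastI_ex)
  have less: "?w j = ?w 0" if "j < m" for j
    using not_less_Least[of j "\<lambda>j. ?w j \<noteq> ?w 0"] that unfolding m_def by blast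
  obtain k where k: "m = Suc k" using m by (cases m) auto
  have "{i::nat. \<forall>j\<le>i. X (n - int j) \<omega> = X n \<omega>} = {..k}"
    using m less unfolding k by (auto simp: word_up_to_def) (metis not_less_eq_eq of_nat_Suc)
  moreover have "(SUP i\<in>{..k}. enat i) = enat k"
    by (rule antisym) (auto intro!: SUP_least SUP_upper)
  ultimately show ?thesis
    using True unfolding memory_def final_run_def m_def[symmetric] k
    by (simp add: one_enat_def)
qed

lemma final_run_ge_1: "1 \<le> final_run w"
proof (cases "\<exists>j. w j \<noteq> w 0")
  case True
  then have "w (LEAST j. w j \<noteq> w 0) \<noteq> w 0" by (rule LeastI_ex)
  then have "(LEAST j. w j \<noteq> w 0) \<noteq> 0" by metis
  then show ?thesis using True by (simp add: final_run_def one_enat_def)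
qed (simp add: final_run_def)

lemma final_run_append:
  "final_run (append_letter w l) = (if l = w 0 then eSuc (final_run w) else 1)"
proof (cases "l = w 0")
  case False
  have "(LEAST j. append_letter w l j \<noteq> append_letter w l 0) = 1"
    using False by (intro Least_equality) (auto simp: append_letter_def Suc_le_eq intro!: gr0I)
  moreover have "append_letter w l 1 \<noteq> append_letter w l 0"
    using False by (auto simp: append_letter_def)
  ultimately show ?thesis using False by (auto simp: final_run_def one_enat_def)
next
  case True
  show ?thesis
  proof (cases "\<exists>j. w j \<noteq> w 0")
    case False
    then have "append_letter w l j = append_letter w l 0" for j
      using True by (auto simp: append_letter_def split: nat.split)
    then show ?thesis using True False by (simp add: final_run_def)
  next
    case ex: True
    then obtain j where j: "w j \<noteq> w 0" by blast
    have "(LEAST j. append_letter w l j \<noteq> l) = Suc (LEAST j. append_letter w l (Suc j) \<noteq> l)"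
      using True j by (intro Least_Suc[of _ "Suc j"]) (auto simp: append_letter_def)
    moreover have "\<exists>j. append_letter w l j \<noteq> l"
      using True j by (intro exI[of _ "Suc j"]) (simp add: append_letter_def)
    ultimately show ?thesis
      using True ex by (simp add: final_run_def append_letter_def eSuc_enat)
  qed
qed

definition memory_state :: "left_word \<Rightarrow> bit \<times> enat" where
  "memory_state w = (w 0, final_run w)"

lemma bit_neq_iff: "(a :: bit) \<noteq> b \<longleftrightarrow> a = 1 - b"
  by (cases a; cases b) auto

lemma memory_state_append:
  "memory_state (append_letter w l) =
     (if l = w 0 then (w 0, eSuc (final_run w)) else (1 - w 0, 1))"
  using final_run_append[of w l] bit_neq_iff[of l "w 0"]
  by (auto simp: memory_state_def append_letter_def)

lemma word_up_to_Suc: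
  "word_up_to X (n + 1) \<omega> = append_letter (word_up_to X n \<omega>) (X (n + 1) \<omega>)"
  by (auto simp: word_up_to_def append_letter_def fun_eq_iff split: nat.split)


lemma measurable_coordinate [measurable]:
  "(\<lambda>w. w n) \<in> left_words \<rightarrow>\<^sub>M count_space UNIV"
  unfolding left_words_def by simp

lemma measurable_left_words:
  assumes "\<And>k. (\<lambda>\<omega>. f \<omega> k) \<in> F \<rightarrow>\<^sub>M count_space UNIV"
  shows "f \<in> F \<rightarrow>\<^sub>M left_words"
  unfolding left_words_def using assms by (rule measurable_abs_UNIV)

lemma space_left_words [simp]: "space left_words = UNIV"
  unfolding left_words_def by (simp add: space_PiM)

lemma space_letter_memory_space: "space letter_memory_space = UNIV \<times> {1..}"
  by (simp add: letter_memory_space_def)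

lemma one_le_eSuc: "1 \<le> eSuc n"
  by (simp add: one_eSuc)

lemma measurable_append_letter [measurable]:
  "(\<lambda>w. append_letter w l) \<in> left_words \<rightarrow>\<^sub>M left_words"
proof (rule measurable_left_words)
  show "(\<lambda>w. append_letter w l k) \<in> left_words \<rightarrow>\<^sub>M count_space UNIV" for k
    by (cases k) (simp_all add: append_letter_def)
qed

lemma measurable_pref [measurable]: "pref \<in> left_words \<rightarrow>\<^sub>M count_space UNIV"
  unfolding pref_def[abs_def] by measurable

lemma measurable_final_run [measurable]: "final_run \<in> left_words \<rightarrow>\<^sub>M count_space UNIV"
  unfolding final_run_def[abs_def] by measurable

lemma measurable_letter_memory_space:
  assumes [measurable]: "X \<in> F \<rightarrow>\<^sub>M count_space UNIV" "M \<in> F \<rightarrow>\<^sub>M count_space UNIV"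
    and "\<And>\<omega>. \<omega> \<in> space F \<Longrightarrow> 1 \<le> M \<omega>"
  shows "(\<lambda>\<omega>. (X \<omega>, M \<omega>)) \<in> F \<rightarrow>\<^sub>M letter_memory_space"
proof -
  have "(\<lambda>\<omega>. (X \<omega>, M \<omega>)) \<in> F \<rightarrow>\<^sub>M count_space (UNIV \<times> {1..})"
  proof (subst measurable_count_space_eq_countable)
    show "countable (UNIV \<times> {1..} :: (bit \<times> enat) set)" by simp
    show "(\<lambda>\<omega>. (X \<omega>, M \<omega>)) \<in> space F \<rightarrow> UNIV \<times> {1..} \<and>
      (\<forall>a\<in>UNIV \<times> {1..}. (\<lambda>\<omega>. (X \<omega>, M \<omega>)) -` {a} \<inter> space F \<in> sets F)"
    proof (intro conjI ballI)
      show "(\<lambda>\<omega>. (X \<omega>, M \<omega>)) \<in> space F \<rightarrow> UNIV \<times> {1..}" using assms(3) by auto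
      fix a :: "bit \<times> enat"
      have "(\<lambda>\<omega>. (X \<omega>, M \<omega>)) -` {a} \<inter> space F =
          (X -` {fst a} \<inter> space F) \<inter> (M -` {snd a} \<inter> space F)"
        by (cases a) auto
      also have "\<dots> \<in> sets F" by measurable
      finally show "(\<lambda>\<omega>. (X \<omega>, M \<omega>)) -` {a} \<inter> space F \<in> sets F" .
    qed
  qed
  then show ?thesis by (simp add: letter_memory_space_def)
qed

lemma measurable_memory_state [measurable]: "memory_state \<in> left_words \<rightarrow>\<^sub>M letter_memory_space"
  unfolding memory_state_def[abs_def]
  by (rule measurable_letter_memory_space) (auto simp: final_run_ge_1)

section \<open>The two transition kernels\<close>

lemma prob_eq_sum_indicator:
  fixes p :: "'c::finite pmf"
  shows "measure_pmf.prob p {x. f x \<in> A} = (\<Sum>x\<in>UNIV. pmf p x * indicator A (f x))"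
proof -
  have "(\<Sum>x\<in>UNIV. pmf p x * indicator A (f x)) = (\<Sum>x\<in>{x. f x \<in> A}. pmf p x)"
    by (rule sum.mono_neutral_cong_right) auto
  then show ?thesis by (simp add: measure_measure_pmf_finite)
qed

lemma measure_letter_memory_kernel:
  fixes \<alpha>1 \<alpha>2 :: "enat \<Rightarrow> real"
  assumes p: "p = (if a = 0 then \<alpha>1 n else \<alpha>2 n)" "0 \<le> p" "p \<le> 1"
    and A: "A \<subseteq> UNIV \<times> {1..}"
  shows "measure (letter_memory_kernel \<alpha>1 \<alpha>2 (a, n)) A =
    p * indicator A (1 - a, 1) + (1 - p) * indicator A (a, eSuc n)"
proof -
  have "measure (letter_memory_kernel \<alpha>1 \<alpha>2 (a, n)) A =
      measure_pmf.prob (bernoulli_pmf p) {b. (if b then (1 - a, 1) else (a, eSuc n)) \<in> A}"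
    unfolding letter_memory_kernel_def prod.case p(1)[symmetric]
    using A by (subst measure_distr) (auto simp: letter_memory_space_def vimage_def one_le_eSuc)
  also have "\<dots> = pmf (bernoulli_pmf p) True * indicator A (1 - a, 1) +
      pmf (bernoulli_pmf p) False * indicator A (a, eSuc n)"
    unfolding prob_eq_sum_indicator UNIV_bool by (simp del: sum_mult_indicator)
  finally show ?thesis using p(2,3) by simp
qed

lemma stochastic_letter_memory_kernel:
  "stochastic_kernel letter_memory_space (letter_memory_kernel \<alpha>1 \<alpha>2)"
  unfolding stochastic_kernel_def
proof (intro conjI ballI)
  show "(\<lambda>s. measure (letter_memory_kernel \<alpha>1 \<alpha>2 s) A) \<in> borel_measurable letter_memory_space" for A
    by (simp add: letter_memory_space_def)
  show "prob_space (letter_memory_kernel \<alpha>1 \<alpha>2 s)" for s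
    unfolding letter_memory_kernel_def
    by (auto split: prod.split simp: letter_memory_space_def one_le_eSuc
        intro!: measure_pmf.prob_space_distr)
qed

lemma measure_comb_kernel:
  assumes "A \<in> sets left_words"
  shows "measure (comb_kernel q w) A =
    (\<Sum>l\<in>UNIV. pmf (q (pref w)) l * indicator A (append_letter w l))"
proof -
  have "measure (comb_kernel q w) A =
      measure_pmf.prob (q (pref w)) {l. append_letter w l \<in> A}"
    unfolding comb_kernel_def using assms
    by (subst measure_distr) (auto simp: vimage_def)
  then show ?thesis unfolding prob_eq_sum_indicator .
qed

lemma stochastic_comb_kernel: "stochastic_kernel left_words (comb_kernel q)"
  unfolding stochastic_kernel_def
proof (intro conjI ballI)
  show "prob_space (comb_kernel q w)" for w
    unfolding comb_kernel_def by (auto intro!: measure_pmf.prob_space_distr)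
  fix A assume A [measurable]: "A \<in> sets left_words"
  show "(\<lambda>w. measure (comb_kernel q w) A) \<in> borel_measurable left_words"
    unfolding measure_comb_kernel[OF A]
  proof (intro borel_measurable_sum borel_measurable_times)
    show "(\<lambda>w. pmf (q (pref w)) l) \<in> borel_measurable left_words" for l
      by (rule measurable_compose[OF measurable_pref]) simp
    show "(\<lambda>w. indicator A (append_letter w l) :: real) \<in> borel_measurable left_words" for l
      by (rule measurable_compose[OF measurable_append_letter borel_measurable_indicator[OF A]])
  qed
qed

lemma pmf_bit_complement: "pmf p (1 - l) = 1 - pmf p (l :: bit)"
proof -
  have "(\<Sum>l\<in>UNIV. pmf p l) = 1" by (rule sum_pmf_eq_1) auto
  then have "pmf p 0 + pmf p 1 = 1" by (simp add: bit_UNIV)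
  then show ?thesis by (cases l) auto
qed

text \<open>For a word ending in \<open>0\<close>, the first letter that differs from the last one is the first
  \<open>1\<close>, so the context and the final run carry the same information. For a word ending in \<open>1\<close> the
  context is always \<open>1\<close>, which is why \<open>\<alpha>2\<close> has to be constant.\<close>

lemma switch_probability:
  assumes q: "comb_parameters \<alpha>1 a2 q" and \<alpha>2: "\<forall>n\<ge>1. \<alpha>2 n = a2"
  shows "pmf (q (pref w)) (1 - w 0) = (if w 0 = 0 then \<alpha>1 (final_run w) else \<alpha>2 (final_run w))"
proof (cases "w 0")
  case one
  have "(LEAST n. w n = 1) = 0" using one by (intro Least_equality) auto
  then have "pref w = Zeros_One 0" using one by (auto simp: pref_def)
  then show ?thesis
    using q \<alpha>2 one final_run_ge_1[of w] by (simp add: comb_parameters_def)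
next
  case zero
  show ?thesis
  proof (cases "\<exists>n. w n = 1")
    case True
    then have "pref w = Zeros_One (LEAST n. w n = 1)" "final_run w = enat (LEAST n. w n = 1)"
      using zero by (auto simp: pref_def final_run_def)
    moreover have "1 \<le> (LEAST n. w n = 1)"
      using final_run_ge_1[of w] unfolding calculation(2) by (simp add: one_enat_def)
    ultimately show ?thesis
      using q zero by (simp add: comb_parameters_def)
  next
    case False
    then show ?thesis
      using q zero by (simp add: comb_parameters_def pref_def final_run_def)
  qed
qed

text \<open>The intertwining of the two kernels. The right-hand side is the probability that, after one step
  of the comb from \<open>w\<close>, the \<open>memory_state\<close> of the new word lies in \<open>A\<close>; a step either switches the
  letter and resets the run to \<open>1\<close>, or prolongs the run.\<close>

lemma comb_kernel_memory_state:
  assumes q: "comb_parameters \<alpha>1 a2 q" and \<alpha>2: "\<forall>n\<ge>1. \<alpha>2 n = a2"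
    and A: "A \<in> sets letter_memory_space"
  shows "measure (letter_memory_kernel \<alpha>1 \<alpha>2 (memory_state w)) A =
    (\<Sum>l\<in>UNIV. pmf (q (pref w)) l * indicator A (memory_state (append_letter w l)))"
proof -
  let ?p = "pmf (q (pref w)) (1 - w 0)"
  have sw: "?p = (if w 0 = 0 then \<alpha>1 (final_run w) else \<alpha>2 (final_run w))"
    by (rule switch_probability[OF q \<alpha>2])
  have A': "A \<subseteq> UNIV \<times> {1..}"
    using A by (simp add: letter_memory_space_def)
  have "measure (letter_memory_kernel \<alpha>1 \<alpha>2 (memory_state w)) A =
      ?p * indicator A (1 - w 0, 1) + (1 - ?p) * indicator A (w 0, eSuc (final_run w))"
    unfolding memory_state_def
    by (rule measure_letter_memory_kernel[where p = ?p, OF _ _ _ A'])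
      (rule sw, simp_all only: pmf_nonneg pmf_le_1)
  also have "1 - ?p = pmf (q (pref w)) (w 0)"
    using pmf_bit_complement[of "q (pref w)" "w 0"] by linarith
  also have "?p * indicator A (1 - w 0, 1) +
        pmf (q (pref w)) (w 0) * indicator A (w 0, eSuc (final_run w)) =
      (\<Sum>l\<in>{1 - w 0, w 0}. pmf (q (pref w)) l * indicator A (memory_state (append_letter w l)))"
    by (cases "w 0") (simp_all add: memory_state_append del: sum_mult_indicator)
  also have "{1 - w 0, w 0} = UNIV"
    by (cases "w 0") (auto simp: bit_UNIV)
  finally show ?thesis .
qed

lemma comb_kernel_vimage_memory_state:
  assumes "comb_parameters \<alpha>1 a2 q" "\<forall>n\<ge>1. \<alpha>2 n = a2" and A: "A \<in> sets letter_memory_space"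
  shows "measure (comb_kernel q w) (memory_state -` A) =
    measure (letter_memory_kernel \<alpha>1 \<alpha>2 (memory_state w)) A"
proof -
  have "memory_state -` A \<in> sets left_words"
    using measurable_sets[OF measurable_memory_state A] by simp
  then show ?thesis
    unfolding comb_kernel_memory_state[OF assms] by (simp add: measure_comb_kernel indicator_def)
qed

text \<open>The converse use of the intertwining: from the state of a word, the letter-memory kernel draws
  the next letter as the comb does.\<close>

lemma letter_memory_kernel_letter:
  assumes "comb_parameters \<alpha>1 a2 q" "\<forall>n\<ge>1. \<alpha>2 n = a2"
  shows "measure (letter_memory_kernel \<alpha>1 \<alpha>2 (memory_state w)) ({l} \<times> {1..}) = pmf (q (pref w)) l"
proof -
  have "{l} \<times> {1..} \<in> sets letter_memory_space" by (auto simp: letter_memory_space_def)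
  from comb_kernel_memory_state[OF assms this] show ?thesis
    by (simp add: memory_state_def append_letter_def final_run_ge_1 indicator_def if_distrib sum.delta cong: if_cong)
qed

text \<open>Only the weight of one of the two letters is prescribed at each leaf, namely that of \<open>0\<close> at
  the leaf \<open>1\<close> and that of \<open>1\<close> at all others; \<open>p\<close> is the resulting weight of \<open>1\<close>.\<close>

lemma comb_parameters_exist:
  assumes "0 \<le> a2" "a2 \<le> 1" "\<forall>n\<ge>1. 0 \<le> \<alpha>1 n \<and> \<alpha>1 n \<le> 1"
  shows "\<exists>q. comb_parameters \<alpha>1 a2 q"
proof -
  define p where "p c = (case c of Zeros_One n \<Rightarrow> if n = 0 then 1 - a2 else \<alpha>1 (enat n)
    | Zeros_Inf \<Rightarrow> \<alpha>1 \<infinity>)" for c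
  define q where "q c = map_pmf (\<lambda>b. if b then 1 else 0 :: bit) (bernoulli_pmf (p c))" for c
  have p: "0 \<le> p c" "p c \<le> 1" for c
    using assms by (auto simp: p_def one_enat_def split: comb_leaf.split)
  have inj: "inj (\<lambda>b. if b then 1 else 0 :: bit)" by (auto simp: inj_def split: if_splits)
  have q1: "pmf (q c) 1 = p c" for c
    using pmf_map_inj'[OF inj, of "bernoulli_pmf (p c)" True] p[of c] by (simp add: q_def)
  have q0: "pmf (q c) 0 = 1 - p c" for c
    using pmf_map_inj'[OF inj, of "bernoulli_pmf (p c)" False] p[of c] by (simp add: q_def)
  have "comb_parameters \<alpha>1 a2 q"
    unfolding comb_parameters_def q0 q1 by (simp add: p_def)
  then show ?thesis by blast
qed


section \<open>Summability from stationarity\<close>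

text \<open>The balance equation for the invariant law, in the case that the set \<open>A\<close> can be entered only from
  \<open>C\<close>, and from there with a constant probability.\<close>

lemma stationary_flow:
  fixes Y :: "nat \<Rightarrow> 'a \<Rightarrow> 's"
  assumes Y: "stationary_markov_chain P S Q Y" and Q: "stochastic_kernel S Q"
    and A: "A \<in> sets S" and C: "C \<in> sets S"
    and flow: "\<And>s. s \<in> space S \<Longrightarrow> measure (Q s) A = c * indicator C s"
  shows "measure P (Y 0 -` A \<inter> space P) = c * measure P (Y 0 -` C \<inter> space P)"
proof -
  have mc: "prob_space P" "\<And>n. Y n \<in> P \<rightarrow>\<^sub>M S"
    and law: "\<And>n. has_cond_law P (past P S Y n) S Q (Y n) (Y (n + 1))"
    using Y unfolding stationary_markov_chain_def markov_chain_iff_cond_law[OF Q] by auto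
  interpret prob_space P by (rule mc)
  have "distr P S (\<lambda>\<omega>. (\<lambda>n. Y (n + 1) \<omega>) 0) = distr P S (\<lambda>\<omega>. (\<lambda>n. Y n \<omega>) 0)"
  proof (rule distr_shift_image[where f = "\<lambda>y. y 0"])
    show "distr P (PiM UNIV (\<lambda>_. S)) (\<lambda>\<omega> n. Y (n + 1) \<omega>) = distr P (PiM UNIV (\<lambda>_. S)) (\<lambda>\<omega> n. Y n \<omega>)"
      using Y unfolding stationary_markov_chain_def stationary_def by blast
  qed (use mc(2) in auto)
  then have "measure (distr P S (Y 1)) A = measure (distr P S (Y 0)) A"
    by simp
  then have "measure P (Y 0 -` A \<inter> space P) = measure P (Y 1 -` A \<inter> space P)"
    using mc(2) A by (simp add: measure_distr)
  also have "\<dots> = (\<integral>\<omega>. indicator (space P) \<omega> * measure (Q (Y 0 \<omega>)) A \<partial>P)"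
    using has_cond_lawD[OF law[of 0] A, of "space P"] sets.top[of "past P S Y 0"]
    by (simp add: Int_commute)
  also have "\<dots> = (\<integral>\<omega>. c * indicator (Y 0 -` C \<inter> space P) \<omega> \<partial>P)"
    using flow measurable_space[OF mc(2)[of 0]]
    by (intro Bochner_Integration.integral_cong) (auto simp: indicator_def)
  also have "\<dots> = c * measure P (Y 0 -` C \<inter> space P)"
    using measurable_sets[OF mc(2)[of 0] C] by simp
  finally show ?thesis .
qed

text \<open>The state \<open>(0, n + 1)\<close> is entered only from \<open>(0, n)\<close>, with probability \<open>1 - \<alpha>1 n\<close>, and the state \<open>(0, 1)\<close>
  only from the states with letter \<open>1\<close>, with probability \<open>a2\<close>. Iterating these balance equations
  gives the summands of \<open>Theta \<alpha>1\<close>, up to the constant \<open>a2 * c\<close>, as the weights of disjoint events.\<close>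

lemma Theta_finite:
  fixes Y :: "nat \<Rightarrow> 'a \<Rightarrow> bit \<times> enat"
  assumes Y: "stationary_markov_chain P letter_memory_space (letter_memory_kernel \<alpha>1 \<alpha>2) Y"
    and \<alpha>1: "\<forall>n\<ge>1. 0 < \<alpha>1 n \<and> \<alpha>1 n < 1" and \<alpha>2: "\<forall>n\<ge>1. 0 < \<alpha>2 n \<and> \<alpha>2 n < 1"
    and a2: "\<forall>n\<ge>1. \<alpha>2 n = a2"
  shows "Theta \<alpha>1 < \<infinity>"
proof -
  have P: "prob_space P" and Ym: "\<And>n. Y n \<in> P \<rightarrow>\<^sub>M letter_memory_space"
    using Y unfolding stationary_markov_chain_def markov_chain_def by auto
  interpret prob_space P by (rule P)
  note flow = stationary_flow[OF Y stochastic_letter_memory_kernel]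
  have a2_pos: "0 < a2" using \<alpha>2 a2 by (metis order_refl)
  have sets_S: "A \<in> sets letter_memory_space \<longleftrightarrow> A \<subseteq> UNIV \<times> {1..}" for A
    by (simp add: letter_memory_space_def)
  have K: "measure (letter_memory_kernel \<alpha>1 \<alpha>2 (a, n)) A =
      (if a = 0 then \<alpha>1 n else \<alpha>2 n) * indicator A (1 - a, 1) +
      (1 - (if a = 0 then \<alpha>1 n else \<alpha>2 n)) * indicator A (a, eSuc n)"
    if "1 \<le> n" "A \<subseteq> UNIV \<times> {1..}" for a n A
    using that \<alpha>1 \<alpha>2 by (intro measure_letter_memory_kernel) (auto simp: less_imp_le)
  define v where "v n = measure P (Y 0 -` {(0, n)} \<inter> space P)" for n
  define c where "c = measure P (Y 0 -` ({1} \<times> {1..}) \<inter> space P)"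
  have v_Suc: "v (eSuc n) = (1 - \<alpha>1 n) * v n" if n: "1 \<le> n" for n
    unfolding v_def
  proof (rule flow)
    fix s assume "s \<in> space letter_memory_space"
    then obtain a m where s: "s = (a, m)" "1 \<le> m"
      by (auto simp: space_letter_memory_space)
    have "eSuc n \<noteq> 1" using n by (auto simp: one_eSuc)
    then show "measure (letter_memory_kernel \<alpha>1 \<alpha>2 s) {(0, eSuc n)} =
        (1 - \<alpha>1 n) * indicator {(0, n)} s"
      using s by (subst s(1), subst K) (auto simp: one_le_eSuc indicator_def)
  qed (use n in \<open>auto simp: sets_S one_le_eSuc\<close>)
  have v_1: "v 1 = a2 * c"
    unfolding v_def c_def
  proof (rule flow)
    fix s assume "s \<in> space letter_memory_space"
    then obtain a m where s: "s = (a, m)" "1 \<le> m"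
      by (auto simp: space_letter_memory_space)
    then have "eSuc m \<noteq> 1" by (auto simp: one_eSuc)
    then show "measure (letter_memory_kernel \<alpha>1 \<alpha>2 s) {(0, 1)} = a2 * indicator ({1} \<times> {1..}) s"
      using s a2 by (subst s(1), subst K) (auto simp: indicator_def)
  qed (auto simp: sets_S)
  have v_fin: "v (enat (Suc n)) = a2 * c * (\<Prod>k\<in>{1..<Suc n}. 1 - \<alpha>1 (enat k))" for n
  proof (induction n)
    case 0
    then show ?case using v_1 by (simp add: one_enat_def)
  next
    case (Suc n)
    have "v (enat (Suc (Suc n))) = (1 - \<alpha>1 (enat (Suc n))) * v (enat (Suc n))"
      using v_Suc[of "enat (Suc n)"] by (simp add: eSuc_enat one_enat_def)
    then show ?case using Suc by simp
  qed
  \<comment> \<open>Since \<^term>\<open>eSuc \<infinity> = \<infinity>\<close>, the balance equation at \<open>\<infinity>\<close> relates \<open>v \<infinity>\<close> to itself.\<close>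
  have v_inf: "v \<infinity> = 0"
  proof -
    have "v \<infinity> = (1 - \<alpha>1 \<infinity>) * v \<infinity>" using v_Suc[of \<infinity>] by simp
    then have "\<alpha>1 \<infinity> * v \<infinity> = 0" by (simp add: algebra_simps)
    moreover have "0 < \<alpha>1 \<infinity>" using \<alpha>1 by simp
    ultimately show ?thesis by simp
  qed
  \<comment> \<open>If \<open>c\<close> vanished, then so would the weights of all states.\<close>
  have "c \<noteq> 0"
  proof
    assume c: "c = 0"
    have zero: "AE \<omega> in P. Y 0 \<omega> \<notin> A"
      if "A \<subseteq> UNIV \<times> {1..}" "measure P (Y 0 -` A \<inter> space P) = 0" for A
    proof -
      have "Y 0 -` A \<inter> space P \<in> null_sets P"
        using that measurable_sets[OF Ym[of 0], of A]
        by (auto simp: null_sets_def emeasure_eq_measure sets_S)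
      then have "AE \<omega> in P. \<omega> \<notin> Y 0 -` A \<inter> space P" by (rule AE_not_in)
      then show ?thesis by (rule AE_mp) (rule AE_I2, auto)
    qed
    have "v n = 0" if n: "1 \<le> n" for n
    proof (cases n)
      case (enat k)
      then obtain j where "n = enat (Suc j)" using n by (cases k) (auto simp: zero_enat_def[symmetric])
      then show ?thesis using v_fin[of j] c by simp
    qed (use v_inf in simp)
    then have "AE \<omega> in P. 1 \<le> n \<longrightarrow> Y 0 \<omega> \<notin> {(0, n)}" for n
      using zero[of "{(0, n)}"] by (cases "1 \<le> n") (auto simp: v_def)
    then have "AE \<omega> in P. \<forall>n. 1 \<le> n \<longrightarrow> Y 0 \<omega> \<notin> {(0, n)}"
      unfolding AE_all_countable by blast
    moreover have "AE \<omega> in P. Y 0 \<omega> \<notin> {1} \<times> {1..}"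
      using c unfolding c_def by (intro zero) auto
    moreover have "AE \<omega> in P. Y 0 \<omega> \<in> UNIV \<times> {1..}"
      using measurable_space[OF Ym[of 0]] by (intro AE_I2) (auto simp: space_letter_memory_space)
    ultimately have "AE \<omega> in P. False"
    proof eventually_elim
      case (elim \<omega>)
      then show ?case by (cases "Y 0 \<omega>"; cases "fst (Y 0 \<omega>)") auto
    qed
    then show False by simp
  qed
  then have pos: "0 < a2 * c"
    using a2_pos by (auto simp: c_def zero_less_measure_iff less_le)
  have "ennreal (a2 * c) * Theta \<alpha>1 = (\<Sum>n. ennreal (a2 * c) * ennreal (\<Prod>k\<in>{1..<Suc n}. 1 - \<alpha>1 (enat k)))"
    unfolding Theta_def by simp
  also have "\<dots> = (\<Sum>n. emeasure P (Y 0 -` {(0, enat (Suc n))} \<inter> space P))"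
    using pos v_fin by (intro suminf_cong) (simp add: ennreal_mult'[symmetric] emeasure_eq_measure v_def)
  also have "\<dots> = emeasure P (\<Union>n. Y 0 -` {(0, enat (Suc n))} \<inter> space P)"
  proof (rule suminf_emeasure)
    show "range (\<lambda>n. Y 0 -` {(0, enat (Suc n))} \<inter> space P) \<subseteq> sets P"
      using measurable_sets[OF Ym[of 0]] by (auto simp: sets_S one_enat_def)
  qed (auto simp: disjoint_family_on_def)
  also have "\<dots> \<le> 1" by (rule emeasure_le_1)
  finally have "ennreal (a2 * c) * Theta \<alpha>1 \<le> 1" .
  then have "Theta \<alpha>1 \<noteq> \<top>"
    using pos by (auto simp: ennreal_mult_top top_unique split: if_splits)
  then show ?thesis by (simp add: less_top)
qed

section \<open>From the letter-memory chain to the comb\<close>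

text \<open>Here \<open>x\<close> and \<open>m\<close> are read backwards in time. A finite memory \<open>k\<close> counts the steps back to the
  last switch, by induction on \<open>k\<close>; an infinite memory has never been reset, so that the letter was
  the same at all earlier times.\<close>

lemma final_run_unique:
  assumes "\<And>j. 1 \<le> m j"
    and "\<And>j. (x j, m j) \<in> {(1 - x (Suc j), 1), (x (Suc j), eSuc (m (Suc j)))}"
  shows "m 0 = final_run x"
proof (cases "m 0")
  case (enat k)
  have x: "append_letter (\<lambda>j. x (Suc j)) (x 0) = x" for x :: left_word
    by (auto simp: append_letter_def fun_eq_iff split: nat.split)
  show ?thesis
    using enat assms
  proof (induction k arbitrary: x m)
    case 0
    then show ?case using "0.prems"(2)[of 0] by (simp add: zero_enat_def[symmetric])
  next
    case (Suc k)
    show ?case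
      using Suc.prems(3)[of 0]
    proof (elim insertE emptyE)
      assume "(x 0, m 0) = (1 - x (Suc 0), 1)"
      then show ?thesis
        using final_run_append[of "\<lambda>j. x (Suc j)" "x 0"] bit_neq_iff[of "x 0" "x (Suc 0)"]
        unfolding x by simp
    next
      assume *: "(x 0, m 0) = (x (Suc 0), eSuc (m (Suc 0)))"
      then have "m (Suc 0) = final_run (\<lambda>j. x (Suc j))"
        using Suc.prems by (intro Suc.IH[of "\<lambda>j. m (Suc j)" "\<lambda>j. x (Suc j)"]) (auto simp: eSuc_enat[symmetric])
      then show ?thesis
        using * final_run_append[of "\<lambda>j. x (Suc j)" "x 0"] unfolding x by simp
    qed
  qed
next
  case infinity
  have "m j = \<infinity> \<and> x j = x 0" for j
  proof (induction j)
    case (Suc j)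
    then show ?case using assms(2)[of j] by (cases "m (Suc j)") (auto simp: eSuc_enat)
  qed (use infinity in simp)
  then show ?thesis by (auto simp: infinity final_run_def)
qed


lemma markov_chain_allowed_transitions:
  fixes Y :: "int \<Rightarrow> 'a \<Rightarrow> bit \<times> enat"
  assumes Y: "markov_chain P letter_memory_space (letter_memory_kernel \<alpha>1 \<alpha>2) Y"
    and \<alpha>: "\<forall>n\<ge>1. 0 \<le> \<alpha>1 n \<and> \<alpha>1 n \<le> 1" "\<forall>n\<ge>1. 0 \<le> \<alpha>2 n \<and> \<alpha>2 n \<le> 1"
  shows "AE \<omega> in P. \<forall>n. Y (n + 1) \<omega> \<in> {(1 - fst (Y n \<omega>), 1), (fst (Y n \<omega>), eSuc (snd (Y n \<omega>)))}"
proof -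
  let ?S = letter_memory_space
  have P: "prob_space P" and Ym: "\<And>n. Y n \<in> P \<rightarrow>\<^sub>M ?S"
    and law: "\<And>n. has_cond_law P (past P ?S Y n) ?S (letter_memory_kernel \<alpha>1 \<alpha>2) (Y n) (Y (n + 1))"
    using Y unfolding markov_chain_iff_cond_law[OF stochastic_letter_memory_kernel] by auto
  have "AE \<omega> in P. Y n \<omega> = (a, m) \<longrightarrow> Y (n + 1) \<omega> \<in> {(1 - a, 1), (a, eSuc m)}" for n a m
  proof (cases "1 \<le> m")
    case True
    \<comment> \<open>The targets that the kernel forbids from the state \<open>(a, m)\<close>.\<close>
    let ?A = "UNIV \<times> {1..} - {(1 - a, 1), (a, eSuc m)}"
    let ?B = "Y n -` {(a, m)} \<inter> space P"
    have "AE \<omega> in P. \<omega> \<in> ?B \<longrightarrow> Y (n + 1) \<omega> \<notin> ?A"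
    proof (rule has_cond_law_null[OF law P])
      show "subalgebra P (past P ?S Y n)" by (rule subalgebra_past[OF Ym])
      show "?A \<in> sets ?S" by (auto simp: letter_memory_space_def)
      have "{(a, m)} \<in> sets ?S" using True by (auto simp: letter_memory_space_def)
      then show "?B \<in> sets (past P ?S Y n)"
        using measurable_sets[OF measurable_past[OF order_refl Ym]] by fastforce
      show "measure (letter_memory_kernel \<alpha>1 \<alpha>2 (Y n \<omega>)) ?A = 0" if "\<omega> \<in> ?B" for \<omega>
      proof -
        have "Y n \<omega> = (a, m)" using that by simp
        moreover have "measure (letter_memory_kernel \<alpha>1 \<alpha>2 (a, m)) ?A = 0"
          using True \<alpha> by (subst measure_letter_memory_kernel[OF refl]) auto
        ultimately show ?thesis by simp
      qed
    qed (rule Ym)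
    moreover have "AE \<omega> in P. Y (n + 1) \<omega> \<in> UNIV \<times> {1..}"
      using measurable_space[OF Ym] by (intro AE_I2) (simp add: space_letter_memory_space)
    moreover have "AE \<omega> in P. \<omega> \<in> space P" by (rule AE_space)
    ultimately show ?thesis by eventually_elim auto
  next
    case False
    have "AE \<omega> in P. Y n \<omega> \<noteq> (a, m)"
      using measurable_space[OF Ym[of n]] False
      by (intro AE_I2) (force simp: space_letter_memory_space)
    then show ?thesis by eventually_elim simp
  qed
  then have "AE \<omega> in P. \<forall>n a m. Y n \<omega> = (a, m) \<longrightarrow> Y (n + 1) \<omega> \<in> {(1 - a, 1), (a, eSuc m)}"
    unfolding AE_all_countable by blast
  then show ?thesis
  proof eventually_elim
    case (elim \<omega>)
    show ?case using elim prod.collapse by metis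
  qed
qed

lemma state_eq_memory_state:
  fixes X :: "int \<Rightarrow> 'a \<Rightarrow> bit" and M :: "int \<Rightarrow> 'a \<Rightarrow> enat"
  assumes Y: "markov_chain P letter_memory_space (letter_memory_kernel \<alpha>1 \<alpha>2) (\<lambda>n \<omega>. (X n \<omega>, M n \<omega>))"
    and \<alpha>: "\<forall>n\<ge>1. 0 \<le> \<alpha>1 n \<and> \<alpha>1 n \<le> 1" "\<forall>n\<ge>1. 0 \<le> \<alpha>2 n \<and> \<alpha>2 n \<le> 1"
  shows "AE \<omega> in P. \<forall>n. (X n \<omega>, M n \<omega>) = memory_state (word_up_to X n \<omega>)"
proof -
  have "AE \<omega> in P. \<forall>n. (X (n + 1) \<omega>, M (n + 1) \<omega>) \<in> {(1 - X n \<omega>, 1), (X n \<omega>, eSuc (M n \<omega>))}"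
    using markov_chain_allowed_transitions[OF Y \<alpha>] by simp
  moreover have "AE \<omega> in P. \<forall>n. 1 \<le> M n \<omega>"
  proof (rule AE_I2, rule allI)
    fix \<omega> n assume \<omega>: "\<omega> \<in> space P"
    have "(\<lambda>\<omega>. (X n \<omega>, M n \<omega>)) \<in> P \<rightarrow>\<^sub>M letter_memory_space"
      using Y unfolding markov_chain_def by blast
    from measurable_space[OF this \<omega>] show "1 \<le> M n \<omega>"
      by (simp add: space_letter_memory_space)
  qed
  ultimately show ?thesis
  proof eventually_elim
    case (elim \<omega>)
    show ?case
    proof
      fix n
      have "M (n - int 0) \<omega> = final_run (\<lambda>j. X (n - int j) \<omega>)"
      proof (rule final_run_unique)
        show "1 \<le> M (n - int j) \<omega>" for j using elim(2) by blast
        show "(X (n - int j) \<omega>, M (n - int j) \<omega>) \<in>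
            {(1 - X (n - int (Suc j)) \<omega>, 1), (X (n - int (Suc j)) \<omega>, eSuc (M (n - int (Suc j)) \<omega>))}" for j
          using elim(1)[rule_format, of "n - int (Suc j)"] by simp
      qed
      then show "(X n \<omega>, M n \<omega>) = memory_state (word_up_to X n \<omega>)"
        by (simp add: memory_state_def word_up_to_def)
    qed
  qed
qed

lemma stationary_word_up_to:
  fixes X :: "int \<Rightarrow> 'a \<Rightarrow> bit" and M :: "int \<Rightarrow> 'a \<Rightarrow> enat"
  assumes st: "stationary P letter_memory_space (\<lambda>n \<omega>. (X n \<omega>, M n \<omega>))"
    and Y: "\<And>n. (\<lambda>\<omega>. (X n \<omega>, M n \<omega>)) \<in> P \<rightarrow>\<^sub>M letter_memory_space"
  shows "stationary P left_words (\<lambda>n. word_up_to X (int n))"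
  unfolding stationary_def
proof
  fix h :: nat
  let ?f = "\<lambda>y (n::nat). (\<lambda>k. fst (y (int n - int k))) :: left_word"
  have fst: "fst \<in> letter_memory_space \<rightarrow>\<^sub>M count_space (UNIV :: bit set)"
    by (simp add: letter_memory_space_def)
  have f: "?f \<in> PiM UNIV (\<lambda>_. letter_memory_space) \<rightarrow>\<^sub>M PiM UNIV (\<lambda>_. left_words)"
    by (intro measurable_abs_UNIV measurable_left_words measurable_compose[OF _ fst]) simp
  have "distr P (PiM UNIV (\<lambda>_. letter_memory_space)) (\<lambda>\<omega> n. (X (n + int h) \<omega>, M (n + int h) \<omega>)) =
      distr P (PiM UNIV (\<lambda>_. letter_memory_space)) (\<lambda>\<omega> n. (X n \<omega>, M n \<omega>))"
    using st unfolding stationary_def by blast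
  from distr_shift_image[where Y = "\<lambda>n \<omega>. (X n \<omega>, M n \<omega>)", OF Y f this]
  show "distr P (PiM UNIV (\<lambda>_. left_words)) (\<lambda>\<omega> n. word_up_to X (int (n + h)) \<omega>) =
      distr P (PiM UNIV (\<lambda>_. left_words)) (\<lambda>\<omega> n. word_up_to X (int n) \<omega>)"
    by (simp add: word_up_to_def[abs_def] algebra_simps)
qed

text \<open>The next word is determined by the present word and the next letter \<open>l\<close>, so the event
  that it lies in \<open>A\<close> splits, over the two values of \<open>l\<close>, into an event \<open>C l\<close> of the past and the
  event that the next letter is \<open>l\<close>. The Markov property of the letter-memory chain applies to each part.\<close>

theorem letter_memory_chain_gives_comb_vlmc:
  fixes X :: "int \<Rightarrow> 'a \<Rightarrow> bit" and M :: "int \<Rightarrow> 'a \<Rightarrow> enat"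
  assumes smc: "stationary_markov_chain P letter_memory_space (letter_memory_kernel \<alpha>1 \<alpha>2)
      (\<lambda>n \<omega>. (X n \<omega>, M n \<omega>))"
    and \<alpha>: "\<forall>n\<ge>1. 0 \<le> \<alpha>1 n \<and> \<alpha>1 n \<le> 1" "\<forall>n\<ge>1. 0 \<le> \<alpha>2 n \<and> \<alpha>2 n \<le> 1" "\<forall>n\<ge>1. \<alpha>2 n = a2"
    and q: "comb_parameters \<alpha>1 a2 q"
  shows "stationary_comb_vlmc P q (\<lambda>n. word_up_to X (int n))"
proof -
  let ?S = letter_memory_space and ?K = "letter_memory_kernel \<alpha>1 \<alpha>2"
  let ?Y = "\<lambda>n \<omega>. (X n \<omega>, M n \<omega>)" and ?U = "\<lambda>n::nat. word_up_to X (int n)"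
  have mc: "markov_chain P ?S ?K ?Y" and st: "stationary P ?S ?Y"
    using smc by (auto simp: stationary_markov_chain_def)
  have P: "prob_space P" and Y [measurable]: "\<And>n. ?Y n \<in> P \<rightarrow>\<^sub>M ?S"
    and law: "\<And>n. has_cond_law P (past P ?S ?Y n) ?S ?K (?Y n) (?Y (n + 1))"
    using mc unfolding markov_chain_iff_cond_law[OF stochastic_letter_memory_kernel] by auto
  interpret prob_space P by (rule P)
  have sub: "subalgebra P (past P ?S ?Y n)" for n by (rule subalgebra_past[OF Y])
  have X: "X k \<in> past P ?S ?Y n \<rightarrow>\<^sub>M count_space UNIV" if "k \<le> n" for k n
  proof -
    have "fst \<in> ?S \<rightarrow>\<^sub>M count_space UNIV" by (simp add: letter_memory_space_def)
    from measurable_compose[OF measurable_past[where Y = ?Y, OF that Y] this] show ?thesis by simp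
  qed
  have U: "?U k \<in> past P ?S ?Y (int n) \<rightarrow>\<^sub>M left_words" if "k \<le> n" for k n
    using X that by (intro measurable_left_words) (simp add: word_up_to_def)
  have UP [measurable]: "?U n \<in> P \<rightarrow>\<^sub>M left_words" for n
    using measurable_from_subalg[OF sub U[OF order_refl]] .
  have state: "AE \<omega> in P. ?Y (int n) \<omega> = memory_state (?U n \<omega>)" for n
    using state_eq_memory_state[OF mc \<alpha>(1,2)] by eventually_elim blast
  have step: "has_cond_law P (past P ?S ?Y (int n)) left_words (comb_kernel q) (?U n) (?U (n + 1))" for n
    unfolding has_cond_law_def
  proof (intro ballI)
    fix A B assume A [measurable]: "A \<in> sets left_words" and B: "B \<in> sets (past P ?S ?Y (int n))"
    have BP [measurable]: "B \<in> sets P" using B sub by (auto simp: subalgebra_def)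
    \<comment> \<open>The events of the past on which appending \<open>l\<close> leads into \<open>A\<close>.\<close>
    define C where "C l = B \<inter> ((\<lambda>\<omega>. append_letter (?U n \<omega>) l) -` A \<inter> space P)" for l
    let ?L = "\<lambda>l. {l} \<times> {1..} :: (bit \<times> enat) set"
    have C: "C l \<in> sets (past P ?S ?Y (int n))" for l
    proof -
      have "(\<lambda>\<omega>. append_letter (?U n \<omega>) l) \<in> past P ?S ?Y (int n) \<rightarrow>\<^sub>M left_words"
        by (rule measurable_compose[OF U[OF order_refl] measurable_append_letter])
      from measurable_sets[OF this A] B show ?thesis unfolding C_def by auto
    qed
    have L: "?L l \<in> sets ?S" for l by (auto simp: letter_memory_space_def)
    have CL: "C l \<inter> ?Y (int n + 1) -` ?L l \<in> sets P" for l
    proof -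
      have "C l \<in> sets P" using C sub by (auto simp: subalgebra_def)
      moreover have "C l \<inter> ?Y (int n + 1) -` ?L l = C l \<inter> (?Y (int n + 1) -` ?L l \<inter> space P)"
        by (auto simp: C_def)
      ultimately show ?thesis using measurable_sets[OF Y L] by auto
    qed
    have memory: "1 \<le> M k \<omega>" if "\<omega> \<in> space P" for k \<omega>
      using measurable_space[OF Y that] by (simp add: space_letter_memory_space)
    have density_meas: "(\<lambda>\<omega>. indicator B \<omega> *
        (pmf (q (pref (?U n \<omega>))) l * indicator A (append_letter (?U n \<omega>) l))) \<in> borel_measurable P" for l
      by (intro borel_measurable_times borel_measurable_indicator BP
        measurable_compose[OF UP measurable_compose[OF measurable_pref]]
        measurable_compose[OF UP measurable_compose[OF measurable_append_letter
          borel_measurable_indicator[OF A]]]) simp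
    have "B \<inter> ?U (n + 1) -` A = (\<Union>l\<in>UNIV. C l \<inter> ?Y (int n + 1) -` ?L l)"
    proof -
      have "?U (n + 1) \<omega> = append_letter (?U n \<omega>) (X (int n + 1) \<omega>)" for \<omega>
        using word_up_to_Suc[of X "int n" \<omega>] by (simp add: add.commute)
      then show ?thesis
        using sets.sets_into_space[OF BP] memory by (auto simp: C_def)
    qed
    then have "measure P (B \<inter> ?U (n + 1) -` A) = (\<Sum>l\<in>UNIV. measure P (C l \<inter> ?Y (int n + 1) -` ?L l))"
      using CL by (simp only:, intro finite_measure_finite_Union)
        (auto simp: disjoint_family_on_def)
    also have "\<dots> = (\<Sum>l\<in>UNIV. \<integral>\<omega>. indicator B \<omega> *
        (pmf (q (pref (?U n \<omega>))) l * indicator A (append_letter (?U n \<omega>) l)) \<partial>P)"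
    proof (rule sum.cong[OF refl])
      fix l
      have "measure P (C l \<inter> ?Y (int n + 1) -` ?L l) =
          (\<integral>\<omega>. indicator (C l) \<omega> * measure (?K (?Y (int n) \<omega>)) (?L l) \<partial>P)"
        by (rule has_cond_lawD[OF law L C])
      also have "\<dots> = (\<integral>\<omega>. indicator B \<omega> *
          (pmf (q (pref (?U n \<omega>))) l * indicator A (append_letter (?U n \<omega>) l)) \<partial>P)"
      proof (rule integral_cong_AE)
        show "AE \<omega> in P. indicator (C l) \<omega> * measure (?K (?Y (int n) \<omega>)) (?L l) =
            indicator B \<omega> * (pmf (q (pref (?U n \<omega>))) l * indicator A (append_letter (?U n \<omega>) l))"
          using state[of n] AE_space
        proof eventually_elim
          case (elim \<omega>)
          show ?case
            unfolding elim(1) letter_memory_kernel_letter[OF q \<alpha>(3)]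
            using elim(2) by (simp add: C_def indicator_def)
        qed
        have "(\<lambda>s. measure (?K s) (?L l)) \<in> borel_measurable ?S"
          by (simp add: letter_memory_space_def)
        from measurable_compose[OF Y this]
        show "(\<lambda>\<omega>. indicator (C l) \<omega> * measure (?K (?Y (int n) \<omega>)) (?L l)) \<in> borel_measurable P"
          using C[of l] sub
          by (intro borel_measurable_times borel_measurable_indicator) (auto simp: subalgebra_def)
      qed (rule density_meas)
      finally show "measure P (C l \<inter> ?Y (int n + 1) -` ?L l) = \<dots>" .
    qed
    also have "\<dots> = (\<integral>\<omega>. (\<Sum>l\<in>UNIV. indicator B \<omega> *
        (pmf (q (pref (?U n \<omega>))) l * indicator A (append_letter (?U n \<omega>) l))) \<partial>P)"
    proof (rule Bochner_Integration.integral_sum[symmetric])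
      fix l
      show "integrable P (\<lambda>\<omega>. indicator B \<omega> *
          (pmf (q (pref (?U n \<omega>))) l * indicator A (append_letter (?U n \<omega>) l)))"
      proof (rule integrable_const_bound[where B = 1])
        show "AE \<omega> in P. norm (indicator B \<omega> *
            (pmf (q (pref (?U n \<omega>))) l * indicator A (append_letter (?U n \<omega>) l))) \<le> 1"
          by (rule AE_I2) (simp add: indicator_def pmf_le_1)
      qed (rule density_meas)
    qed
    also have "\<dots> = (\<integral>\<omega>. indicator B \<omega> * measure (comb_kernel q (?U n \<omega>)) A \<partial>P)"
      unfolding measure_comb_kernel[OF A] sum_distrib_left ..
    finally show "measure P (B \<inter> ?U (n + 1) -` A) =
        (\<integral>\<omega>. indicator B \<omega> * measure (comb_kernel q (?U n \<omega>)) A \<partial>P)" .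
  qed
  have "has_cond_law P (past P left_words ?U n) left_words (comb_kernel q) (?U n) (?U (n + 1))" for n
    by (rule has_cond_law_mono[OF step], rule sets_past_least) (simp, rule U)
  then have "markov_chain P left_words (comb_kernel q) ?U"
    unfolding markov_chain_iff_cond_law[OF stochastic_comb_kernel] using P UP by blast
  with stationary_word_up_to[OF st Y] show ?thesis
    by (simp add: stationary_comb_vlmc_def stationary_markov_chain_def)
qed


section \<open>From the comb to the letter-memory chain\<close>

lemma letter_int: "letter U (int n) \<omega> = U n \<omega> 0"
  by (simp add: letter_def)

text \<open>The comb kernel at \<open>w\<close> is carried by the two words that extend \<open>w\<close>.\<close>

lemma comb_vlmc_consistent:
  assumes "markov_chain P left_words (comb_kernel q) U"
  shows "AE \<omega> in P. \<forall>n k. U (Suc n) \<omega> (Suc k) = U n \<omega> k"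
proof -
  have P: "prob_space P" and U: "\<And>n. U n \<in> P \<rightarrow>\<^sub>M left_words"
    and law: "\<And>n. has_cond_law P (past P left_words U n) left_words (comb_kernel q) (U n) (U (n + 1))"
    using assms unfolding markov_chain_iff_cond_law[OF stochastic_comb_kernel] by auto
  have "AE \<omega> in P. U n \<omega> k = b \<longrightarrow> U (Suc n) \<omega> (Suc k) = b" for n k b
  proof -
    \<comment> \<open>Consistency fails only if, for some \<open>n\<close>, \<open>k\<close> and \<open>b\<close>, the event \<open>?B\<close> occurs and the next
      word lies in \<open>?A\<close>.\<close>
    let ?A = "{w. w (Suc k) \<noteq> b}" and ?B = "U n -` {w. w k = b} \<inter> space P"
    have A: "?A \<in> sets left_words"
      using measurable_sets[OF measurable_coordinate[of "Suc k"], of "- {b}"]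
      by (simp add: vimage_def)
    have "{w. w k = b} \<in> sets left_words"
      using measurable_sets[OF measurable_coordinate[of k], of "{b}"] by (simp add: vimage_def)
    then have B: "?B \<in> sets (past P left_words U n)"
      using measurable_sets[OF measurable_past[where Y = U and n = n, OF order_refl U]]
      by (metis space_past)
    have "AE \<omega> in P. \<omega> \<in> ?B \<longrightarrow> U (n + 1) \<omega> \<notin> ?A"
    proof (rule has_cond_law_null[OF law P subalgebra_past[OF U] U A B])
      fix \<omega> assume "\<omega> \<in> ?B"
      then show "measure (comb_kernel q (U n \<omega>)) ?A = 0"
        unfolding measure_comb_kernel[OF A] by (simp add: append_letter_def)
    qed
    with AE_space show ?thesis by eventually_elim auto
  qed
  then have "AE \<omega> in P. \<forall>n k b. U n \<omega> k = b \<longrightarrow> U (Suc n) \<omega> (Suc k) = b"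
    unfolding AE_all_countable by blast
  then show ?thesis by eventually_elim blast
qed

text \<open>On a consistent trajectory every word is the left half of one and the same two-sided sequence,
  cut at its own time.\<close>

lemma letter_diff_of_consistent:
  assumes "\<And>n k. U (Suc n) \<omega> (Suc k) = U n \<omega> k"
  shows "letter U (int n - int k) \<omega> = U n \<omega> k"
proof -
  have shift: "U (n + j) \<omega> (k + j) = U n \<omega> k" for n k j
    by (induction j) (simp_all add: assms)
  show ?thesis
  proof (cases "k \<le> n")
    case True
    then have "int n - int k = int (n - k)" by simp
    moreover have "U n \<omega> k = U (n - k) \<omega> 0"
      using shift[of "n - k" k 0] True by simp
    ultimately show ?thesis by (simp only: letter_int)
  next
    case False
    then have "nat (- (int n - int k)) = k - n" "\<not> 0 \<le> int n - int k" by simp_all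
    moreover have "U n \<omega> k = U 0 \<omega> (k - n)"
      using shift[of 0 n "k - n"] False by simp
    ultimately show ?thesis by (simp only: letter_def if_False)
  qed
qed

text \<open>As a function of a word this is measurable as soon as the letters are. By \<open>two_sided_state_eq\<close>
  below, it is the pair of \<^const>\<open>letter\<close> and \<^const>\<open>memory\<close> at all times, including the
  negative ones.\<close>

definition two_sided_state :: "(nat \<Rightarrow> 'a \<Rightarrow> left_word) \<Rightarrow> int \<Rightarrow> 'a \<Rightarrow> bit \<times> enat" where
  "two_sided_state U n \<omega> = memory_state (word_up_to (letter U) n \<omega>)"

lemma two_sided_state_eq:
  "two_sided_state U n \<omega> = (letter U n \<omega>, memory (letter U) n \<omega>)"
  by (simp add: two_sided_state_def memory_state_def memory_eq_final_run word_up_to_def)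

text \<open>At a negative time the state depends on the initial word alone, which is why the bound is
  \<open>max 0 n\<close>.\<close>

lemma measurable_two_sided_state:
  assumes "\<And>k. int k \<le> max 0 n \<Longrightarrow> U k \<in> F \<rightarrow>\<^sub>M left_words"
  shows "two_sided_state U n \<in> F \<rightarrow>\<^sub>M letter_memory_space"
proof -
  have "letter U k \<in> F \<rightarrow>\<^sub>M count_space UNIV" if "k \<le> n" for k
  proof (cases "0 \<le> k")
    case True
    then have "U (nat k) \<in> F \<rightarrow>\<^sub>M left_words" using that by (intro assms) simp
    from measurable_compose[OF this measurable_coordinate[of 0]] True
    show ?thesis by (simp add: letter_def[abs_def])
  next
    case False
    have "U 0 \<in> F \<rightarrow>\<^sub>M left_words" by (intro assms) simp
    from measurable_compose[OF this measurable_coordinate[of "nat (- k)"]] False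
    show ?thesis by (simp add: letter_def[abs_def])
  qed
  then have "word_up_to (letter U) n \<in> F \<rightarrow>\<^sub>M left_words"
    by (intro measurable_left_words) (simp add: word_up_to_def)
  from measurable_compose[OF this measurable_memory_state] show ?thesis
    by (simp add: two_sided_state_def[abs_def])
qed

lemma two_sided_state_shift:
  assumes "\<And>n k. U (Suc n) \<omega> (Suc k) = U n \<omega> k"
  shows "two_sided_state (\<lambda>m. U (m + h)) n \<omega> = two_sided_state U (n + int h) \<omega>"
proof -
  have "letter (\<lambda>m. U (m + h)) k \<omega> = letter U (k + int h) \<omega>" for k
  proof (cases "0 \<le> k")
    case True
    then show ?thesis by (simp add: letter_def nat_add_distrib)
  next
    case False
    then have "letter U (k + int h) \<omega> = U h \<omega> (nat (- k))"
      using letter_diff_of_consistent[of U \<omega> h "nat (- k)", OF assms] by (simp add: add.commute)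
    then show ?thesis using False by (simp add: letter_def)
  qed
  then show ?thesis
    by (simp add: two_sided_state_def word_up_to_def algebra_simps)
qed

text \<open>The two-sided process is a fixed function of the sequence of words, and almost surely it
  commutes with forward shifts: shifting the words by \<open>h\<close> replaces the initial word by the one at time
  \<open>h\<close>, whose letters are, by consistency, those that the shift has moved to nonpositive times.\<close>

lemma stationary_two_sided_state:
  fixes U :: "nat \<Rightarrow> 'a \<Rightarrow> left_word"
  assumes st: "stationary P left_words U" and U: "\<And>n. U n \<in> P \<rightarrow>\<^sub>M left_words"
    and cons: "AE \<omega> in P. \<forall>n k. U (Suc n) \<omega> (Suc k) = U n \<omega> k"
  shows "stationary P letter_memory_space (two_sided_state U)"
proof (rule stationary_if_forward_shifts)
  show Y: "two_sided_state U n \<in> P \<rightarrow>\<^sub>M letter_memory_space" for n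
    by (rule measurable_two_sided_state) (rule U)
  fix h :: nat
  let ?Pi = "PiM UNIV (\<lambda>_. letter_memory_space) :: (int \<Rightarrow> bit \<times> enat) measure"
  let ?f = "\<lambda>u n. two_sided_state (\<lambda>m u. u m) n u"
  have f: "?f \<in> PiM UNIV (\<lambda>_. left_words) \<rightarrow>\<^sub>M ?Pi"
    by (intro measurable_abs_UNIV measurable_two_sided_state) simp
  have as_f: "(\<lambda>n. two_sided_state V n \<omega>) = ?f (\<lambda>n. V n \<omega>)" for V :: "nat \<Rightarrow> 'a \<Rightarrow> left_word" and \<omega>
    by (simp add: fun_eq_iff two_sided_state_def word_up_to_def letter_def)
  have "distr P (PiM UNIV (\<lambda>_. left_words)) (\<lambda>\<omega> n. U (n + h) \<omega>) =
      distr P (PiM UNIV (\<lambda>_. left_words)) (\<lambda>\<omega> n. U n \<omega>)"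
    using st unfolding stationary_def by blast
  from distr_shift_image[OF U f this]
  have *: "distr P ?Pi (\<lambda>\<omega> n. two_sided_state (\<lambda>m. U (m + h)) n \<omega>) =
      distr P ?Pi (\<lambda>\<omega> n. two_sided_state U n \<omega>)"
    unfolding as_f .
  have "distr P ?Pi (\<lambda>\<omega> n. two_sided_state U (n + int h) \<omega>) =
      distr P ?Pi (\<lambda>\<omega> n. two_sided_state (\<lambda>m. U (m + h)) n \<omega>)"
  proof (rule distr_cong_AE[OF refl refl])
    show "AE \<omega> in P. (\<lambda>n. two_sided_state U (n + int h) \<omega>) =
        (\<lambda>n. two_sided_state (\<lambda>m. U (m + h)) n \<omega>)"
      using cons
    proof eventually_elim
      case (elim \<omega>)
      then show ?case by (simp add: fun_eq_iff two_sided_state_shift)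
    qed
    show "(\<lambda>\<omega> n. two_sided_state U (n + int h) \<omega>) \<in> P \<rightarrow>\<^sub>M ?Pi"
      by (intro measurable_abs_UNIV Y)
    show "(\<lambda>\<omega> n. two_sided_state (\<lambda>m. U (m + h)) n \<omega>) \<in> P \<rightarrow>\<^sub>M ?Pi"
      by (intro measurable_abs_UNIV measurable_two_sided_state U)
  qed
  with * show "distr P ?Pi (\<lambda>\<omega> n. two_sided_state U (n + int h) \<omega>) =
      distr P ?Pi (\<lambda>\<omega> n. two_sided_state U n \<omega>)" by simp
qed

text \<open>The intertwining, integrated over an event of the past of the words.\<close>

lemma two_sided_state_cond_law:
  fixes U :: "nat \<Rightarrow> 'a \<Rightarrow> left_word"
  assumes mc: "markov_chain P left_words (comb_kernel q) U"
    and q: "comb_parameters \<alpha>1 a2 q" and \<alpha>2: "\<forall>n\<ge>1. \<alpha>2 n = a2"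
  shows "has_cond_law P (past P left_words U n) letter_memory_space (letter_memory_kernel \<alpha>1 \<alpha>2)
    (two_sided_state U (int n)) (two_sided_state U (int n + 1))"
proof -
  have U: "\<And>n. U n \<in> P \<rightarrow>\<^sub>M left_words"
    and law: "\<And>n. has_cond_law P (past P left_words U n) left_words (comb_kernel q) (U n) (U (n + 1))"
    using mc unfolding markov_chain_iff_cond_law[OF stochastic_comb_kernel] by auto
  have state: "AE \<omega> in P. memory_state (U n \<omega>) = two_sided_state U (int n) \<omega>" for n
    using comb_vlmc_consistent[OF mc]
  proof eventually_elim
    case (elim \<omega>)
    then have "word_up_to (letter U) (int n) \<omega> = U n \<omega>"
      by (simp add: fun_eq_iff word_up_to_def letter_diff_of_consistent)
    then show ?case by (simp add: two_sided_state_def)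
  qed
  have lumped: "has_cond_law P (past P left_words U n) letter_memory_space (letter_memory_kernel \<alpha>1 \<alpha>2)
      (\<lambda>\<omega>. memory_state (U n \<omega>)) (\<lambda>\<omega>. memory_state (U (n + 1) \<omega>))"
    unfolding has_cond_law_def
  proof (intro ballI)
    fix A B assume A: "A \<in> sets letter_memory_space" and B: "B \<in> sets (past P left_words U n)"
    have "memory_state -` A \<in> sets left_words"
      using measurable_sets[OF measurable_memory_state A] by simp
    from has_cond_lawD[OF law this B, unfolded comb_kernel_vimage_memory_state[OF q \<alpha>2 A]]
    show "measure P (B \<inter> (\<lambda>\<omega>. memory_state (U (n + 1) \<omega>)) -` A) =
        (\<integral>\<omega>. indicator B \<omega> * measure (letter_memory_kernel \<alpha>1 \<alpha>2 (memory_state (U n \<omega>))) A \<partial>P)"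
      by (simp add: vimage_def)
  qed
  have meas: "(\<lambda>\<omega>. memory_state (U k \<omega>)) \<in> P \<rightarrow>\<^sub>M letter_memory_space"
      "two_sided_state U j \<in> P \<rightarrow>\<^sub>M letter_memory_space" for k j
    using measurable_compose[OF U measurable_memory_state]
    by (simp, intro measurable_two_sided_state U)
  show ?thesis
  proof (rule has_cond_law_cong_AE[OF lumped])
    show "AE \<omega> in P. memory_state (U (n + 1) \<omega>) = two_sided_state U (int n + 1) \<omega>"
      using state[of "n + 1"] by (simp add: add.commute)
  qed (rule subalgebra_past[OF U] stochastic_letter_memory_kernel state meas)+
qed

theorem theorem3p1:
  fixes \<alpha>1 \<alpha>2 :: "enat \<Rightarrow> real" and a2 :: real
  assumes "\<forall>n\<ge>1. 0 < \<alpha>1 n \<and> \<alpha>1 n < 1"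
    and "\<forall>n\<ge>1. 0 < \<alpha>2 n \<and> \<alpha>2 n < 1"
    and "\<forall>n\<ge>1. \<alpha>2 n = a2"
  shows
    "(\<forall>(P :: 'a measure) (X :: int \<Rightarrow> 'a \<Rightarrow> bit) (M :: int \<Rightarrow> 'a \<Rightarrow> enat).
        stationary_markov_chain P letter_memory_space (letter_memory_kernel \<alpha>1 \<alpha>2)
          (\<lambda>n \<omega>. (X n \<omega>, M n \<omega>)) \<and>
        Theta \<alpha>1 < \<infinity> \<longrightarrow>
        (\<exists>q. comb_parameters \<alpha>1 a2 q \<and>
           stationary_comb_vlmc P q (\<lambda>n. word_up_to X (int n))) \<and>
        distr P left_words (word_up_to X (int 0)) =
          distr P left_words (\<lambda>\<omega> k. X (- int k) \<omega>))
     \<and>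
     (\<forall>(P :: 'b measure) (q :: comb_leaf \<Rightarrow> bit pmf) (U :: nat \<Rightarrow> 'b \<Rightarrow> left_word).
        stationary_comb_vlmc P q U \<and> comb_parameters \<alpha>1 a2 q \<longrightarrow>
        (let X = letter U; M = memory X;
             Y = (\<lambda>(n::nat) \<omega>. (X (int n) \<omega>, M (int n) \<omega>)) in
           Theta \<alpha>1 < \<infinity> \<and>
           stationary_markov_chain P letter_memory_space (letter_memory_kernel \<alpha>1 \<alpha>2) Y \<and>
           (\<exists>N :: (int \<Rightarrow> bit \<times> enat) measure.
              stationary_markov_chain N letter_memory_space (letter_memory_kernel \<alpha>1 \<alpha>2)
                (\<lambda>n \<omega>. \<omega> n) \<and>
              distr N (PiM UNIV (\<lambda>_. letter_memory_space)) (\<lambda>\<omega> (n::nat). \<omega> (int n)) =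
              distr P (PiM UNIV (\<lambda>_. letter_memory_space)) (\<lambda>\<omega> n. Y n \<omega>))))"
proof (intro conjI allI impI)
  fix P :: "'a measure" and X :: "int \<Rightarrow> 'a \<Rightarrow> bit" and M :: "int \<Rightarrow> 'a \<Rightarrow> enat"
  assume *: "stationary_markov_chain P letter_memory_space (letter_memory_kernel \<alpha>1 \<alpha>2)
      (\<lambda>n \<omega>. (X n \<omega>, M n \<omega>)) \<and> Theta \<alpha>1 < \<infinity>"
  have \<alpha>: "\<forall>n\<ge>1. 0 \<le> \<alpha>1 n \<and> \<alpha>1 n \<le> 1" "\<forall>n\<ge>1. 0 \<le> \<alpha>2 n \<and> \<alpha>2 n \<le> 1"
    using assms by (auto intro: less_imp_le)
  have "0 \<le> a2" "a2 \<le> 1" using assms(3) \<alpha>(2) by (metis order_refl)+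
  then obtain q where q: "comb_parameters \<alpha>1 a2 q"
    using comb_parameters_exist \<alpha>(1) by blast
  show "\<exists>q. comb_parameters \<alpha>1 a2 q \<and> stationary_comb_vlmc P q (\<lambda>n. word_up_to X (int n))"
    using letter_memory_chain_gives_comb_vlmc[OF _ \<alpha> assms(3) q] * q by blast
  show "distr P left_words (word_up_to X (int 0)) = distr P left_words (\<lambda>\<omega> k. X (- int k) \<omega>)"
    by (simp add: word_up_to_def[abs_def])
next
  fix P :: "'b measure" and q and U :: "nat \<Rightarrow> 'b \<Rightarrow> left_word"
  assume *: "stationary_comb_vlmc P q U \<and> comb_parameters \<alpha>1 a2 q"
  let ?S = letter_memory_space and ?K = "letter_memory_kernel \<alpha>1 \<alpha>2"
  let ?Y = "two_sided_state U"
  have mc: "markov_chain P left_words (comb_kernel q) U" and st: "stationary P left_words U"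
    using * by (auto simp: stationary_comb_vlmc_def stationary_markov_chain_def)
  have P: "prob_space P" and U: "\<And>n. U n \<in> P \<rightarrow>\<^sub>M left_words"
    using mc by (auto simp: markov_chain_def)
  have Y: "?Y n \<in> P \<rightarrow>\<^sub>M ?S" for n
    by (rule measurable_two_sided_state) (rule U)
  have YU: "?Y k \<in> past P left_words U n \<rightarrow>\<^sub>M ?S" if "k \<le> int n" for k n
    using that by (intro measurable_two_sided_state measurable_past U) simp
  have stY: "stationary P ?S ?Y"
    by (rule stationary_two_sided_state[OF st U comb_vlmc_consistent[OF mc]])
  have law: "has_cond_law P (past P left_words U n) ?S ?K (?Y (int n)) (?Y (int n + 1))" for n
    using two_sided_state_cond_law[OF mc _ assms(3)] * by blast
  have law_int: "has_cond_law P (past P ?S ?Y n) ?S ?K (?Y n) (?Y (n + 1))" if n: "0 \<le> n" for n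
  proof -
    have "has_cond_law P (past P left_words U (nat n)) ?S ?K (?Y n) (?Y (n + 1))"
      using law[of "nat n"] n by simp
    then show ?thesis
    proof (rule has_cond_law_mono)
      show "sets (past P ?S ?Y n) \<subseteq> sets (past P left_words U (nat n))"
        by (rule sets_past_least) (use n in \<open>auto intro: YU\<close>)
    qed
  qed
  let ?Z = "\<lambda>n::nat. ?Y (int n)"
  have "has_cond_law P (past P ?S ?Z n) ?S ?K (?Z n) (?Z (n + 1))" for n
  proof -
    have "has_cond_law P (past P ?S ?Z n) ?S ?K (?Y (int n)) (?Y (int n + 1))"
      by (rule has_cond_law_mono[OF law], rule sets_past_least) (auto intro: YU)
    then show ?thesis by (simp add: add.commute)
  qed
  then have "markov_chain P ?S ?K ?Z"
    unfolding markov_chain_iff_cond_law[OF stochastic_letter_memory_kernel] using P Y by blast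
  then have smc: "stationary_markov_chain P ?S ?K ?Z"
    using stationary_restrict[OF stY Y] by (simp add: stationary_markov_chain_def)
  let ?N = "distr P (PiM UNIV (\<lambda>_. ?S)) (\<lambda>\<omega> n. ?Y n \<omega>)"
  have N: "stationary_markov_chain ?N ?S ?K (\<lambda>n \<omega>. \<omega> n)"
    by (rule canonical_stationary_markov_chain[OF P stochastic_letter_memory_kernel Y stY law_int])
  have restr: "distr ?N (PiM UNIV (\<lambda>_. ?S)) (\<lambda>\<omega> (n::nat). \<omega> (int n)) =
      distr P (PiM UNIV (\<lambda>_. ?S)) (\<lambda>\<omega> n. (letter U (int n) \<omega>, memory (letter U) (int n) \<omega>))"
    unfolding two_sided_state_eq[symmetric] using Y by (subst distr_distr) (auto intro!: measurable_abs_UNIV simp: comp_def)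
  have Z: "(\<lambda>(n::nat) \<omega>. (letter U (int n) \<omega>, memory (letter U) (int n) \<omega>)) = ?Z"
    by (simp add: fun_eq_iff two_sided_state_eq)
  show "let X = letter U; M = memory X;
             Y = (\<lambda>(n::nat) \<omega>. (X (int n) \<omega>, M (int n) \<omega>)) in
           Theta \<alpha>1 < \<infinity> \<and>
           stationary_markov_chain P letter_memory_space (letter_memory_kernel \<alpha>1 \<alpha>2) Y \<and>
           (\<exists>N :: (int \<Rightarrow> bit \<times> enat) measure.
              stationary_markov_chain N letter_memory_space (letter_memory_kernel \<alpha>1 \<alpha>2)
                (\<lambda>n \<omega>. \<omega> n) \<and>
              distr N (PiM UNIV (\<lambda>_. letter_memory_space)) (\<lambda>\<omega> (n::nat). \<omega> (int n)) =
              distr P (PiM UNIV (\<lambda>_. letter_memory_space)) (\<lambda>\<omega> n. Y n \<omega>))"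
    unfolding Let_def Z
    by (intro conjI exI[of _ ?N]) (rule Theta_finite[OF smc assms] smc N restr)+
qed

end
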